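(* Let $\mathcal W$ be the set of real lists $\lambda=(\lambda_1,\ldots,\lambda_5)$ with $\lambda_1\ge\lambda_2\ge\lambda_3\ge\lambda_4\ge\lambda_5$ which, with $S=\sum_{i=1}^5\lambda_i$, satisfy all of the following: $\lambda_1=\max_i|\lambda_i|$; $\lambda_1>\lambda_2\ge\lambda_3>0>\lambda_4\ge\lambda_5$; $0<S<\min\{\lambda_3,\lambda_1/2\}$; and $4\lambda_1\le 9\lambda_3-S$. Then no list in $\mathcal W$ is the spectrum (counted with multiplicity) of a real symmetric entrywise-nonnegative $5\times5$ matrix.
   Context: A matrix is entrywise-nonnegative if all its entries are $\ge 0$. The spectrum of a matrix is its list of eigenvalues counted with multiplicity. *)

theory Defs
  imports "Jordan_Normal_Form.Char_Poly" "HOL-Computational_Algebra.Polynomial"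
begin

text \<open>
  The eigenvalues are taken over the complex numbers; the multiplicity of an eigenvalue is its
  order as a root of the characteristic polynomial.  A list is represented up to reordering by
  the multiset of its entries.
\<close>
definition real_mat_spectrum :: "real mat \<Rightarrow> complex multiset" where
  "real_mat_spectrum A = proots (char_poly (map_mat complex_of_real A))"

definition is_spectrum_of :: "real list \<Rightarrow> real mat \<Rightarrow> bool" where
  "is_spectrum_of ls A \<longleftrightarrow> real_mat_spectrum A = mset (map complex_of_real ls)"

definition entrywise_nonneg :: "real mat \<Rightarrow> bool" where
  "entrywise_nonneg A \<longleftrightarrow> (\<forall>i < dim_row A. \<forall>j < dim_col A. A $$ (i, j) \<ge> 0)"

definition W_lists :: "real list set" where
  "W_lists = {[l1, l2, l3, l4, l5] | l1 l2 l3 l4 l5.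
     let S = l1 + l2 + l3 + l4 + l5 in
       l1 \<ge> l2 \<and> l2 \<ge> l3 \<and> l3 \<ge> l4 \<and> l4 \<ge> l5 \<and>
       l1 = Max {\<bar>l1\<bar>, \<bar>l2\<bar>, \<bar>l3\<bar>, \<bar>l4\<bar>, \<bar>l5\<bar>} \<and>
       l1 > l2 \<and> l2 \<ge> l3 \<and> l3 > 0 \<and> 0 > l4 \<and> l4 \<ge> l5 \<and>
       0 < S \<and> S < min l3 (l1 / 2) \<and>
       4 * l1 \<le> 9 * l3 - S}"

end

theory Submission
  imports Defs "Jordan_Normal_Form.Schur_Decomposition"
begin

text \<open>
  Let \<open>A\<close> be symmetric, entrywise nonnegative, of order five, with eigenvalues
  \<open>l1 \<ge> l2 \<ge> l3 \<ge> l4 \<ge> l5\<close> and trace \<open>S < l3\<close>. The claim is \<open>9 * l3 - S < 4 * l1\<close>, which the lists in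
  question violate. Written as \<open>4 * (l1 - l3) > 5 * l3 - S\<close> it says that the largest eigenvalue of
  \<open>A - l3 * I\<close> exceeds a quarter of the negated trace of that matrix.
  
  Take \<open>t\<close> with \<open>S < t < l3\<close> and put \<open>F = A - t * I\<close>. The off-diagonal entries of \<open>F\<close> are nonnegative and
  its diagonal entries are negative, yet \<open>F\<close> is positive definite on the span of three eigenvectors
  of \<open>A\<close>. That is a strong combinatorial restriction. In a plane on which \<open>F\<close> is positive definite one can
  rotate a vector until its positive and its negative part have the same value under \<open>F\<close>
  (\<open>balanced_vector\<close>). Since the diagonal is negative, each part then lives on at least two indices.
  Intersecting the three-dimensional space with a coordinate hyperplane shows that every quartet of indices
  splits into two pairs, each pair joined by an entry that is large compared with the diagonal and
  with the entries between the pairs (\<open>quartet_splits\<close>, \<open>splits_edge\<close>, \<open>splits_dominates\<close>,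
  \<open>splits_product_bound\<close>).
  
  There are five quartets and each chooses one of three pairings. No edge can be chosen for all three
  quartets that contain it, because eliminating its two indices would leave a positive plane on only three
  indices (\<open>no_edge_in_three_splits\<close>). All other choices that do not come from a pentagon are refuted by multiplying
  dominance inequalities, so what remains are the five matchings of a pentagon (\<open>ex_split_pentagon\<close>).
  
  With \<open>e i = t - A i i\<close>, write the entry on a pentagon edge \<open>i j\<close> as \<open>sqrt (e i * e j) * x\<close>. Then every weight
  \<open>x\<close> is at least \<open>1\<close>, and the weights of two disjoint pentagon edges have product at least \<open>2\<close>. An
  explicit test vector for the Rayleigh quotient of \<open>A\<close> turns this into a lower bound on \<open>l1 - t\<close>
  (\<open>pentagon_cycle_bound\<close>). The bound keeps a surplus that stays positive as \<open>t\<close> tends to \<open>l3\<close>, which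
  gives the strict inequality (\<open>third_eigenvalue_bound\<close>).
\<close>

section \<open>Quadratic forms, split pairs and balanced vectors\<close>

definition form :: "'a set \<Rightarrow> ('a \<Rightarrow> 'a \<Rightarrow> real) \<Rightarrow> ('a \<Rightarrow> real) \<Rightarrow> ('a \<Rightarrow> real) \<Rightarrow> real" where
  "form I F u w = (\<Sum>i\<in>I. \<Sum>j\<in>I. F i j * u i * w j)"

text \<open>
  A Metzler matrix has nonnegative off-diagonal entries. The matrices \<open>A - t * I\<close> considered here are
  moreover symmetric and have a negative diagonal, because \<open>t\<close> exceeds the trace of \<open>A\<close>.
\<close>

definition sym_metzler :: "'a set \<Rightarrow> ('a \<Rightarrow> 'a \<Rightarrow> real) \<Rightarrow> bool" where
  "sym_metzler I F \<longleftrightarrow> (\<forall>i\<in>I. F i i < 0) \<and> (\<forall>i\<in>I. \<forall>j\<in>I. F i j = F j i \<and> (i \<noteq> j \<longrightarrow> 0 \<le> F i j))"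

text \<open>
  The sign pattern \<open>(x, y, - z, - w)\<close> on \<open>a, b, c, d\<close> is a vector whose positive part and whose negative part
  both have a larger value under \<open>F\<close> than their mutual product \<open>\<kappa>\<close>. Keeping only these two inequalities
  makes the notion symmetric in the two pairs and in the members of each pair.
\<close>

definition splits :: "('a \<Rightarrow> 'a \<Rightarrow> real) \<Rightarrow> 'a \<Rightarrow> 'a \<Rightarrow> 'a \<Rightarrow> 'a \<Rightarrow> bool" where
  "splits F a b c d \<longleftrightarrow> (\<exists>x y z w. 0 < x \<and> 0 < y \<and> 0 < z \<and> 0 < w \<and>
     (let \<kappa> = F a c * x * z + F a d * x * w + F b c * y * z + F b d * y * w in
       \<kappa> < F a a * x\<^sup>2 + F b b * y\<^sup>2 + 2 * F a b * x * y \<and>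
       \<kappa> < F c c * z\<^sup>2 + F d d * w\<^sup>2 + 2 * F c d * z * w))"

lemma form_diff:
  assumes "sym_metzler I F"
  shows "form I F (\<lambda>i. p i - n i) (\<lambda>i. p i - n i) = form I F p p + form I F n n - 2 * form I F p n"
proof -
  have "form I F n p = form I F p n"
    unfolding form_def using assms
    by (subst sum.swap) (auto simp: sym_metzler_def mult_ac intro!: sum.cong)
  moreover have "form I F (\<lambda>i. p i - n i) (\<lambda>i. p i - n i) 
     = form I F p p + form I F n n - form I F n p - form I F p n"
    unfolding form_def by (simp add: algebra_simps sum.distrib sum_subtractf)
  ultimately show ?thesis by simp
qed

lemma form_disjoint_nonneg:
  assumes "sym_metzler I F"
  shows "0 \<le> form I F (\<lambda>i. max (u i) 0) (\<lambda>i. max (- u i) 0)"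
  unfolding form_def
proof (intro sum_nonneg)
  fix i j assume "i \<in> I" "j \<in> I"
  thus "0 \<le> F i j * max (u i) 0 * max (- u j) 0"
    using assms by (cases "i = j") (auto simp: sym_metzler_def max_def)
qed

text \<open>
  Rotate a vector through half a turn of the plane. The value of the positive part minus the value of the
  negative part changes sign, so the two values agree somewhere. At that vector positivity of the form reads
  \<open>2 * value - 2 * mixed > 0\<close>.
\<close>

lemma balanced_vector:
  assumes "finite I" "sym_metzler I F"
    and pos: "\<And>s t. s \<noteq> 0 \<or> t \<noteq> 0 \<Longrightarrow>
      0 < form I F (\<lambda>i. s * u i + t * w i) (\<lambda>i. s * u i + t * w i)"
  obtains v where
    "form I F (\<lambda>i. max (v i) 0) (\<lambda>i. max (- v i) 0) < form I F (\<lambda>i. max (v i) 0) (\<lambda>i. max (v i) 0)"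
    "form I F (\<lambda>i. max (v i) 0) (\<lambda>i. max (- v i) 0) < form I F (\<lambda>i. max (- v i) 0) (\<lambda>i. max (- v i) 0)"
proof -
  \<comment> \<open>\<open>f\<close> is odd under the half turn, so it vanishes at some angle\<close>
  define v where "v = (\<lambda>\<theta> i. cos \<theta> * u i + sin \<theta> * w i)"
  define f where "f = (\<lambda>\<theta>. form I F (\<lambda>i. max (v \<theta> i) 0) (\<lambda>i. max (v \<theta> i) 0)
                        - form I F (\<lambda>i. max (- v \<theta> i) 0) (\<lambda>i. max (- v \<theta> i) 0))"
  have cont: "continuous_on A f" for A
    unfolding f_def form_def v_def by (intro continuous_intros)
  have "f pi = - f 0" unfolding f_def v_def by simp
  have "\<exists>\<theta>. f \<theta> = 0"
  proof (cases "f 0 \<le> 0")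
    case True
    thus ?thesis using IVT'[of f 0 0 pi] cont \<open>f pi = - f 0\<close> by auto
  next
    case False
    thus ?thesis using IVT2'[of f pi 0 0] cont \<open>f pi = - f 0\<close> by auto
  qed
  then obtain \<theta> where \<theta>: "f \<theta> = 0" ..
  have "v \<theta> = (\<lambda>i. max (v \<theta> i) 0 - max (- v \<theta> i) 0)" by (auto simp: max_def)
  moreover have "0 < form I F (v \<theta>) (v \<theta>)"
    unfolding v_def using sin_zero_abs_cos_one by (intro pos) force
  ultimately show ?thesis
    using that[of "v \<theta>"] \<theta> form_diff[OF assms(2), of "\<lambda>i. max (v \<theta> i) 0" "\<lambda>i. max (- v \<theta> i) 0"]
    unfolding f_def by simp
qed

text \<open>
  The diagonal contributes nonpositive terms only, so a positive value needs an off-diagonal one.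
\<close>

lemma positive_support:
  assumes M: "sym_metzler I F" and w: "\<forall>i. 0 \<le> w i" and pos: "0 < form I F w w"
  shows "\<exists>i\<in>I. \<exists>j\<in>I. i \<noteq> j \<and> 0 < w i \<and> 0 < w j"
proof (rule ccontr)
  assume contra: "\<not> ?thesis"
  have "form I F w w \<le> 0"
    unfolding form_def
  proof (intro sum_nonpos)
    fix i j assume "i \<in> I" "j \<in> I"
    hence "i = j \<or> w i = 0 \<or> w j = 0" using contra w by (metis order.order_iff_strict)
    moreover have "F i i \<le> 0" using M \<open>i \<in> I\<close> by (simp add: sym_metzler_def less_imp_le)
    hence "F i i * (w i * w i) \<le> 0" by (intro mult_nonpos_nonneg) auto
    ultimately show "F i j * w i * w j \<le> 0" by (auto simp: mult.assoc)
  qed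
  thus False using pos by simp
qed

lemma balanced_signs:
  assumes "finite I" "sym_metzler I F"
    and pos: "\<And>s t. s \<noteq> 0 \<or> t \<noteq> 0 \<Longrightarrow>
      0 < form I F (\<lambda>i. s * u i + t * w i) (\<lambda>i. s * u i + t * w i)"
  obtains v where "\<exists>i\<in>I. \<exists>j\<in>I. i \<noteq> j \<and> 0 < v i \<and> 0 < v j"
    "\<exists>k\<in>I. \<exists>l\<in>I. k \<noteq> l \<and> v k < 0 \<and> v l < 0"
    "form I F (\<lambda>i. max (v i) 0) (\<lambda>i. max (- v i) 0) < form I F (\<lambda>i. max (v i) 0) (\<lambda>i. max (v i) 0)"
    "form I F (\<lambda>i. max (v i) 0) (\<lambda>i. max (- v i) 0) < form I F (\<lambda>i. max (- v i) 0) (\<lambda>i. max (- v i) 0)"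
proof -
  from balanced_vector[OF assms] obtain v where v:
    "form I F (\<lambda>i. max (v i) 0) (\<lambda>i. max (- v i) 0) < form I F (\<lambda>i. max (v i) 0) (\<lambda>i. max (v i) 0)"
    "form I F (\<lambda>i. max (v i) 0) (\<lambda>i. max (- v i) 0) < form I F (\<lambda>i. max (- v i) 0) (\<lambda>i. max (- v i) 0)"
    by blast
  note nn = form_disjoint_nonneg[OF assms(2), of v]
  have "0 < form I F (\<lambda>i. max (v i) 0) (\<lambda>i. max (v i) 0)" using nn v by linarith
  from positive_support[OF assms(2) _ this]
  have "\<exists>i\<in>I. \<exists>j\<in>I. i \<noteq> j \<and> 0 < v i \<and> 0 < v j" by (simp add: less_max_iff_disj)
  moreover have "0 < form I F (\<lambda>i. max (- v i) 0) (\<lambda>i. max (- v i) 0)" using nn v by linarith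
  from positive_support[OF assms(2) _ this]
  have "\<exists>k\<in>I. \<exists>l\<in>I. k \<noteq> l \<and> v k < 0 \<and> v l < 0" by (simp add: less_max_iff_disj)
  ultimately show ?thesis using v by (rule that)
qed

text \<open>
  A balanced vector needs two indices of each sign.
\<close>

lemma no_positive_plane_3:
  assumes "sym_metzler {a, b, c} F"
    and pos: "\<And>s t. s \<noteq> 0 \<or> t \<noteq> 0 \<Longrightarrow>
      0 < form {a, b, c} F (\<lambda>i. s * u i + t * w i) (\<lambda>i. s * u i + t * w i)"
  shows False
proof -
  have fin: "finite {a, b, c}" by simp
  obtain v where "\<exists>i\<in>{a, b, c}. \<exists>j\<in>{a, b, c}. i \<noteq> j \<and> 0 < v i \<and> 0 < v j"
    "\<exists>k\<in>{a, b, c}. \<exists>l\<in>{a, b, c}. k \<noteq> l \<and> v k < 0 \<and> v l < 0"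
    "form {a, b, c} F (\<lambda>i. max (v i) 0) (\<lambda>i. max (- v i) 0)
      < form {a, b, c} F (\<lambda>i. max (v i) 0) (\<lambda>i. max (v i) 0)"
    "form {a, b, c} F (\<lambda>i. max (v i) 0) (\<lambda>i. max (- v i) 0)
      < form {a, b, c} F (\<lambda>i. max (- v i) 0) (\<lambda>i. max (- v i) 0)"
    by (rule balanced_signs[OF fin assms])
  then obtain i j k l where v: "i \<in> {a, b, c}" "j \<in> {a, b, c}" "i \<noteq> j" "0 < v i" "0 < v j"
    "k \<in> {a, b, c}" "l \<in> {a, b, c}" "k \<noteq> l" "v k < 0" "v l < 0" by blast
  have "{i, j, k, l} \<subseteq> {a, b, c}" using v(1,2,6,7) by blast
  hence "card {i, j, k, l} \<le> card {a, b, c}" by (intro card_mono) auto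
  moreover have "card {i, j, k, l} = 4" using v by auto
  moreover have "card {a, b, c} \<le> 3" by (simp add: card_insert_if)
  ultimately show False by simp
qed

lemma splits_sym:
  assumes "sym_metzler I F" "{a, b, c, d} \<subseteq> I" "splits F a b c d"
  shows "splits F b a c d" "splits F a b d c" "splits F c d a b"
proof -
  have sym: "F i j = F j i" if "i \<in> I" "j \<in> I" for i j
    using assms(1) that unfolding sym_metzler_def by blast
  from assms obtain x y z w where pos: "0 < x" "0 < y" "0 < z" "0 < w" and
    ineq: "F a c * x * z + F a d * x * w + F b c * y * z + F b d * y * w 
             < F a a * x\<^sup>2 + F b b * y\<^sup>2 + 2 * F a b * x * y"
      "F a c * x * z + F a d * x * w + F b c * y * z + F b d * y * w
             < F c c * z\<^sup>2 + F d d * w\<^sup>2 + 2 * F c d * z * w"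
    unfolding splits_def Let_def by blast
  show "splits F b a c d" unfolding splits_def Let_def
    by (rule exI[of _ y], rule exI[of _ x], rule exI[of _ z], rule exI[of _ w])
      (use pos ineq sym[of b a] assms(2) in \<open>simp add: mult_ac\<close>)
  show "splits F a b d c" unfolding splits_def Let_def
    by (rule exI[of _ x], rule exI[of _ y], rule exI[of _ w], rule exI[of _ z])
      (use pos ineq sym[of c d] assms(2) in \<open>simp add: mult_ac\<close>)
  show "splits F c d a b" unfolding splits_def Let_def
    by (rule exI[of _ z], rule exI[of _ w], rule exI[of _ x], rule exI[of _ y])
      (use pos ineq sym[of a c] sym[of a d] sym[of b c] sym[of b d] assms(2) in \<open>simp add: mult_ac\<close>)
qed

lemma splits_of_signs:
  assumes M: "sym_metzler I F" and I: "I = {a, b, c, d}" and dist: "distinct [a, b, c, d]"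
    and signs: "0 < v a" "0 < v b" "v c < 0" "v d < 0"
    and bal: "form I F (\<lambda>i. max (v i) 0) (\<lambda>i. max (- v i) 0) < form I F (\<lambda>i. max (v i) 0) (\<lambda>i. max (v i) 0)"
    "form I F (\<lambda>i. max (v i) 0) (\<lambda>i. max (- v i) 0) < form I F (\<lambda>i. max (- v i) 0) (\<lambda>i. max (- v i) 0)"
  shows "splits F a b c d"
proof -
  have sym: "F b a = F a b" "F d c = F c d" using M unfolding sym_metzler_def I by blast+
  have max: "max (v a) 0 = v a" "max (v b) 0 = v b" "max (v c) 0 = 0" "max (v d) 0 = 0"
    "max (- v a) 0 = 0" "max (- v b) 0 = 0" "max (- v c) 0 = - v c" "max (- v d) 0 = - v d"
    using signs by auto
  have ne: "a \<noteq> b" "a \<noteq> c" "a \<noteq> d" "b \<noteq> c" "b \<noteq> d" "c \<noteq> d" using dist by auto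
  have "form I F (\<lambda>i. max (v i) 0) (\<lambda>i. max (- v i) 0)
      = F a c * v a * (- v c) + F a d * v a * (- v d) + F b c * v b * (- v c) + F b d * v b * (- v d)"
    unfolding form_def I using ne by (simp add: max)
  moreover have "form I F (\<lambda>i. max (v i) 0) (\<lambda>i. max (v i) 0)
      = F a a * (v a)\<^sup>2 + F b b * (v b)\<^sup>2 + 2 * F a b * v a * v b"
    unfolding form_def I using ne by (simp add: max sym power2_eq_square)
  moreover have "form I F (\<lambda>i. max (- v i) 0) (\<lambda>i. max (- v i) 0)
      = F c c * (- v c)\<^sup>2 + F d d * (- v d)\<^sup>2 + 2 * F c d * (- v c) * (- v d)"
    unfolding form_def I using ne by (simp add: max sym power2_eq_square)
  ultimately show ?thesis
    unfolding splits_def Let_def using signs bal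
    by - (rule exI[of _ "v a"], rule exI[of _ "v b"], rule exI[of _ "- v c"], rule exI[of _ "- v d"], simp)
qed

text \<open>
  With four indices a balanced vector has exactly two of each sign, and its signs are the required pairing.
\<close>

lemma positive_plane_splits:
  assumes M: "sym_metzler {a, b, c, d} F" and dist: "distinct [a, b, c, d]"
    and pos: "\<And>s t. s \<noteq> 0 \<or> t \<noteq> 0 \<Longrightarrow>
      0 < form {a, b, c, d} F (\<lambda>i. s * u i + t * w i) (\<lambda>i. s * u i + t * w i)"
  shows "splits F a b c d \<or> splits F a c b d \<or> splits F a d b c"
proof -
  have fin: "finite {a, b, c, d}" by simp
  obtain v where v: "\<exists>i\<in>{a, b, c, d}. \<exists>j\<in>{a, b, c, d}. i \<noteq> j \<and> 0 < v i \<and> 0 < v j"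
    "\<exists>k\<in>{a, b, c, d}. \<exists>l\<in>{a, b, c, d}. k \<noteq> l \<and> v k < 0 \<and> v l < 0"
    and bal: "form {a, b, c, d} F (\<lambda>i. max (v i) 0) (\<lambda>i. max (- v i) 0)
      < form {a, b, c, d} F (\<lambda>i. max (v i) 0) (\<lambda>i. max (v i) 0)"
    "form {a, b, c, d} F (\<lambda>i. max (v i) 0) (\<lambda>i. max (- v i) 0)
      < form {a, b, c, d} F (\<lambda>i. max (- v i) 0) (\<lambda>i. max (- v i) 0)"
    by (rule balanced_signs[OF fin M pos])
  from v obtain i j k l where ij: "i \<in> {a, b, c, d}" "j \<in> {a, b, c, d}" "i \<noteq> j" "0 < v i" "0 < v j"
    and kl: "k \<in> {a, b, c, d}" "l \<in> {a, b, c, d}" "k \<noteq> l" "v k < 0" "v l < 0" by blast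
  have sub: "{i, j, k, l} \<subseteq> {a, b, c, d}" using ij(1,2) kl(1,2) by blast
  have dist': "distinct [i, j, k, l]" using ij(3-5) kl(3-5) by auto
  have "card {a, b, c, d} = card {i, j, k, l}" using dist dist' by simp
  hence I: "{a, b, c, d} = {i, j, k, l}" using card_subset_eq[OF fin sub] by simp
  have s: "splits F i j k l"
    by (rule splits_of_signs[OF M I dist' ij(4,5) kl(4,5) bal])
  have swap: "splits F q p r s" "splits F p q s r" "splits F r s p q"
    if "splits F p q r s" "{p, q, r, s} = {a, b, c, d}" for p q r s
    using splits_sym[OF M _ that(1)] that(2) by auto
  have "\<exists>j k l. splits F a j k l \<and> {a, j, k, l} = {a, b, c, d}"
  proof -
    have "a = i \<or> a = j \<or> a = k \<or> a = l" using I by blast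
    thus ?thesis
    proof (elim disjE)
      assume "a = i" thus ?thesis using s I by blast
    next
      assume "a = j"
      moreover have "splits F j i k l" by (rule swap(1)[OF s I[symmetric]])
      moreover have "{j, i, k, l} = {a, b, c, d}" unfolding I by auto
      ultimately show ?thesis by blast
    next
      assume "a = k"
      moreover have "splits F k l i j" by (rule swap(3)[OF s I[symmetric]])
      moreover have "{k, l, i, j} = {a, b, c, d}" unfolding I by auto
      ultimately show ?thesis by blast
    next
      assume "a = l"
      moreover have "splits F k l i j" by (rule swap(3)[OF s I[symmetric]])
      moreover have "{k, l, i, j} = {a, b, c, d}" "{l, k, i, j} = {a, b, c, d}" unfolding I by auto
      ultimately show ?thesis using swap(1) by blast
    qed
  qed
  then obtain j' k' l' where s': "splits F a j' k' l'" and I': "{a, j', k', l'} = {a, b, c, d}" by blast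
  have "card {a, j', k', l'} = 4" unfolding I' using dist by simp
  hence "distinct [a, j', k', l']" using card_distinct[of "[a, j', k', l']"] by simp
  hence D: "j' \<noteq> k'" "j' \<noteq> l'" "k' \<noteq> l'" "a \<notin> {j', k', l'}" by auto
  have "{j', k', l'} = {a, b, c, d} - {a}" unfolding I'[symmetric] using D(4) by blast
  also have "\<dots> = {b, c, d}" using dist by auto
  finally have J: "{j', k', l'} = {b, c, d}" .
  have "{k', l'} = {j', k', l'} - {j'}" using D(1,2) by blast
  hence K: "{k', l'} = {b, c, d} - {j'}" unfolding J .
  note s'' = swap(2)[OF s' I']
  consider "j' = b" | "j' = c" | "j' = d" using J by blast
  thus ?thesis
  proof cases
    case 1
    hence "{k', l'} = {c, d}" using K dist by auto
    thus ?thesis using 1 s' s'' by (auto simp: doubleton_eq_iff)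
  next
    case 2
    hence "{k', l'} = {b, d}" using K dist by auto
    thus ?thesis using 2 s' s'' by (auto simp: doubleton_eq_iff)
  next
    case 3
    hence "{k', l'} = {b, c}" using K dist by auto
    thus ?thesis using 3 s' s'' by (auto simp: doubleton_eq_iff)
  qed
qed

section \<open>Inequalities forced by a split pair\<close>

lemma splitsE:
  assumes "splits F a b c d"
  obtains x y z w where "0 < x" "0 < y" "0 < z" "0 < w"
    "F a c * x * z + F a d * x * w + F b c * y * z + F b d * y * w
       < F a a * x\<^sup>2 + F b b * y\<^sup>2 + 2 * F a b * x * y"
    "F a c * x * z + F a d * x * w + F b c * y * z + F b d * y * w
       < F c c * z\<^sup>2 + F d d * w\<^sup>2 + 2 * F c d * z * w"
  using assms unfolding splits_def Let_def by blast

lemma sym_metzlerD: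
  assumes "sym_metzler I F" "i \<in> I" "j \<in> I"
  shows "F i i < 0" "F i j = F j i" "i \<noteq> j \<Longrightarrow> 0 \<le> F i j"
  using assms unfolding sym_metzler_def by blast+

text \<open>
  A \<open>2 \<times> 2\<close> form with negative diagonal that takes a positive value is indefinite.
\<close>

lemma timelike_edge:
  fixes x y p q m k :: real
  assumes "0 < x" "0 < y" "p < 0" "q < 0" "0 \<le> k" "k < p * x\<^sup>2 + q * y\<^sup>2 + 2 * m * x * y"
  shows "0 < m" "p * q < m\<^sup>2"
proof -
  have "0 < - p * x\<^sup>2" "0 < - q * y\<^sup>2" using assms by (simp_all add: mult_neg_pos)
  hence lt: "0 < - p * x\<^sup>2 + - q * y\<^sup>2" "- p * x\<^sup>2 + - q * y\<^sup>2 < 2 * m * x * y"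
    using assms by linarith+
  hence "0 < m * (x * y)" by (simp add: mult.assoc)
  thus "0 < m" using assms zero_less_mult_pos2[of m "x * y"] by simp
  have "(p * q) * (4 * (x * y)\<^sup>2) \<le> (- p * x\<^sup>2 + - q * y\<^sup>2)\<^sup>2"
    using zero_le_power2[of "p * x\<^sup>2 - q * y\<^sup>2"] by (simp add: power2_eq_square algebra_simps)
  also have "\<dots> < (2 * m * x * y)\<^sup>2"
    using lt by (intro power_strict_mono) auto
  also have "\<dots> = m\<^sup>2 * (4 * (x * y)\<^sup>2)" by (simp add: power2_eq_square)
  finally show "p * q < m\<^sup>2" using assms by simp
qed

lemma splits_edge:
  assumes M: "sym_metzler I F" and sub: "{a, b, c, d} \<subseteq> I" and dist: "distinct [a, b, c, d]"
    and s: "splits F a b c d"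
  shows "0 < F a b" "F a a * F b b < (F a b)\<^sup>2"
proof -
  obtain x y z w where pos: "0 < x" "0 < y" "0 < z" "0 < w" and
    ineq: "F a c * x * z + F a d * x * w + F b c * y * z + F b d * y * w
       < F a a * x\<^sup>2 + F b b * y\<^sup>2 + 2 * F a b * x * y"
    using s by (rule splitsE)
  have cross: "0 \<le> F a c" "0 \<le> F a d" "0 \<le> F b c" "0 \<le> F b d" and diag: "F a a < 0" "F b b < 0"
    using sym_metzlerD[OF M] sub dist by auto
  have "0 \<le> F a c * x * z + F a d * x * w + F b c * y * z + F b d * y * w"
    using pos cross by (intro add_nonneg_nonneg mult_nonneg_nonneg) auto
  from timelike_edge[OF pos(1,2) diag this ineq]
  show "0 < F a b" "F a a * F b b < (F a b)\<^sup>2" .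
qed

lemma am_gm_cross:
  fixes p q k m n X Y :: real
  assumes "0 \<le> p" "0 \<le> q" "0 < X" "0 < Y" "p * X + q * Y \<le> k" "k < 2 * m" "k < 2 * n"
  shows "p * q * (X * Y) < m * n"
proof -
  have "0 \<le> p * X + q * Y" using assms by (intro add_nonneg_nonneg mult_nonneg_nonneg) auto
  hence "0 \<le> k" using assms(5) by linarith
  have "4 * (p * q * (X * Y)) \<le> (p * X + q * Y)\<^sup>2"
    using zero_le_power2[of "p * X - q * Y"] by (simp add: power2_eq_square algebra_simps)
  also have "\<dots> \<le> k\<^sup>2" using assms(5) \<open>0 \<le> p * X + q * Y\<close> by (rule power_mono)
  also have "\<dots> < (2 * m) * (2 * n)"
    unfolding power2_eq_square using \<open>0 \<le> k\<close> assms(6,7) by (intro mult_strict_mono') auto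
  finally show ?thesis by simp
qed

text \<open>
  Multiply the two inequalities of the split. The mixed term is at least the sum of its contributions from
  one of the competing pairings, and the square of that sum is at least four times their product.
\<close>

lemma splits_dominates:
  assumes M: "sym_metzler I F" and sub: "{a, b, c, d} \<subseteq> I" and dist: "distinct [a, b, c, d]"
    and s: "splits F a b c d"
  shows "F a c * F b d < F a b * F c d" "F a d * F b c < F a b * F c d"
proof -
  obtain x y z w where pos: "0 < x" "0 < y" "0 < z" "0 < w" and
    ineq: "F a c * x * z + F a d * x * w + F b c * y * z + F b d * y * w
       < F a a * x\<^sup>2 + F b b * y\<^sup>2 + 2 * F a b * x * y"
      "F a c * x * z + F a d * x * w + F b c * y * z + F b d * y * w
       < F c c * z\<^sup>2 + F d d * w\<^sup>2 + 2 * F c d * z * w"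
    using s by (rule splitsE)
  define k where "k = F a c * x * z + F a d * x * w + F b c * y * z + F b d * y * w"
  have cross: "0 \<le> F a c" "0 \<le> F a d" "0 \<le> F b c" "0 \<le> F b d"
    and diag: "F a a < 0" "F b b < 0" "F c c < 0" "F d d < 0"
    using sym_metzlerD[OF M] sub dist by auto
  have "F a a * x\<^sup>2 \<le> 0" "F b b * y\<^sup>2 \<le> 0" "F c c * z\<^sup>2 \<le> 0" "F d d * w\<^sup>2 \<le> 0"
    using diag by (simp_all add: mult_nonpos_nonneg)
  hence k: "k < 2 * (F a b * (x * y))" "k < 2 * (F c d * (z * w))"
    using ineq unfolding k_def by (simp_all add: mult.assoc)
  have t: "0 \<le> F a c * x * z" "0 \<le> F a d * x * w" "0 \<le> F b c * y * z" "0 \<le> F b d * y * w"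
    using pos cross by simp_all
  have "F a c * F b d * ((x * z) * (y * w)) < (F a b * (x * y)) * (F c d * (z * w))"
    using pos cross k t by (intro am_gm_cross[where k = k]) (auto simp: k_def mult.assoc)
  hence "(F a c * F b d) * (x * y * z * w) < (F a b * F c d) * (x * y * z * w)" by (simp only: mult_ac)
  thus "F a c * F b d < F a b * F c d" using pos by simp
  have "F a d * F b c * ((x * w) * (y * z)) < (F a b * (x * y)) * (F c d * (z * w))"
    using pos cross k t by (intro am_gm_cross[where k = k]) (auto simp: k_def mult.assoc)
  hence "(F a d * F b c) * (x * y * z * w) < (F a b * F c d) * (x * y * z * w)" by (simp only: mult_ac)
  thus "F a d * F b c < F a b * F c d" using pos by simp
qed

text \<open>
  With \<open>T = Y + Z\<close> the right-hand side is \<open>(X\<^sup>2 + Y * T) * (W\<^sup>2 + Z * T)\<close>; apply the inequality of the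
  means to \<open>X\<^sup>2 * Z, Y * W\<^sup>2\<close> and to \<open>Y, Z\<close>, whose geometric mean is \<open>r\<close>.
\<close>

lemma four_variable_am_gm:
  fixes X Y Z W :: real
  assumes "0 \<le> X" "0 \<le> Y" "0 \<le> Z" "0 \<le> W"
  shows "8 * (X * Y * Z * W) \<le> (X\<^sup>2 + Y\<^sup>2 + Y * Z) * (Z\<^sup>2 + W\<^sup>2 + Y * Z)"
proof -
  define T where "T = Y + Z"
  define r where "r = sqrt (Y * Z)"
  have r: "0 \<le> r" "r * r = Y * Z" using assms by (auto simp: r_def)
  have "2 * r \<le> T" unfolding r_def T_def using arith_geo_mean_sqrt[of Y Z] assms by simp
  have "2 * (X * W * r) \<le> X\<^sup>2 * Z + Y * W\<^sup>2"
  proof -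
    have "2 * sqrt ((X\<^sup>2 * Z) * (Y * W\<^sup>2)) \<le> X\<^sup>2 * Z + Y * W\<^sup>2"
      using arith_geo_mean_sqrt[of "X\<^sup>2 * Z" "Y * W\<^sup>2"] assms by simp
    moreover have "sqrt ((X\<^sup>2 * Z) * (Y * W\<^sup>2)) = X * W * r"
      unfolding r_def using assms by (simp add: real_sqrt_mult)
    ultimately show ?thesis by simp
  qed
  hence "(2 * r) * (2 * (X * W * r)) \<le> T * (X\<^sup>2 * Z + Y * W\<^sup>2)"
    using \<open>2 * r \<le> T\<close> r assms by (intro mult_mono) auto
  moreover have "(2 * r) * (2 * (X * W * r)) = 4 * (X * W) * (r * r)" by simp
  moreover have "4 * (X * W) * (r * r) = 4 * (X * Y * Z * W)" unfolding r by simp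
  ultimately have "4 * (X * Y * Z * W) \<le> T * (X\<^sup>2 * Z + Y * W\<^sup>2)" by linarith
  moreover have "0 \<le> (X * W - r * T)\<^sup>2" by simp
  moreover have "(X * W - r * T)\<^sup>2 = X\<^sup>2 * W\<^sup>2 - 2 * (X * W * r) * T + (Y * Z) * T\<^sup>2"
    unfolding r(2)[symmetric] by (simp add: power2_eq_square algebra_simps)
  moreover have "(2 * r) * (X * W * r) \<le> T * (X * W * r)" 
    using \<open>2 * r \<le> T\<close> r assms by (intro mult_right_mono) auto
  moreover have "(2 * r) * (X * W * r) = 2 * (X * W) * (r * r)" by simp
  moreover have "2 * (X * W) * (r * r) = 2 * (X * Y * Z * W)" unfolding r by simp
  moreover have "(X\<^sup>2 + Y\<^sup>2 + Y * Z) * (Z\<^sup>2 + W\<^sup>2 + Y * Z)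
     = X\<^sup>2 * W\<^sup>2 + T * (X\<^sup>2 * Z + Y * W\<^sup>2) + (Y * Z) * T\<^sup>2"
    unfolding T_def by (simp add: power2_eq_square algebra_simps)
  moreover have "2 * (X * W * r) * T = 2 * (T * (X * W * r))" by simp
  ultimately show ?thesis by linarith
qed

text \<open>
  When the entry between \<open>b\<close> and \<open>c\<close> is itself large, the mixed term of the split is large, and this
  lifts the trivial bound \<open>1\<close> for the normalized product of the split pair to \<open>2\<close>. Equality is
  approached by the path with normalized weights \<open>sqrt 2, 1, sqrt 2\<close>.
\<close>

lemma splits_product_bound:
  assumes M: "sym_metzler I F" and sub: "{a, b, c, d} \<subseteq> I" and dist: "distinct [a, b, c, d]"
    and s: "splits F a b c d"
    and roots: "0 < ra" "0 < rb" "0 < rc" "0 < rd"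
      "F a a = - ra\<^sup>2" "F b b = - rb\<^sup>2" "F c c = - rc\<^sup>2" "F d d = - rd\<^sup>2"
    and bc: "rb * rc \<le> F b c"
  shows "2 * (ra * rb * rc * rd) \<le> F a b * F c d"
proof -
  obtain x y z w where pos: "0 < x" "0 < y" "0 < z" "0 < w" and
    ineq: "F a c * x * z + F a d * x * w + F b c * y * z + F b d * y * w
       < F a a * x\<^sup>2 + F b b * y\<^sup>2 + 2 * F a b * x * y"
      "F a c * x * z + F a d * x * w + F b c * y * z + F b d * y * w
       < F c c * z\<^sup>2 + F d d * w\<^sup>2 + 2 * F c d * z * w"
    using s by (rule splitsE)
  have cross: "0 \<le> F a c" "0 \<le> F a d" "0 \<le> F b d"
    using sym_metzlerD[OF M] sub dist by auto
  have t: "0 \<le> F a c * x * z" "0 \<le> F a d * x * w" "0 \<le> F b d * y * w"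
    using pos cross by simp_all
  have "(rb * rc) * (y * z) \<le> F b c * (y * z)" using bc pos by (intro mult_right_mono) auto
  hence yz: "(rb * y) * (rc * z) \<le> F b c * y * z" by (simp add: mult_ac)
  have 1: "(ra * x)\<^sup>2 + (rb * y)\<^sup>2 + (rb * y) * (rc * z) \<le> 2 * (F a b * (x * y))"
    using ineq(1) t yz unfolding roots by (simp add: power_mult_distrib mult_ac)
  have 2: "(rc * z)\<^sup>2 + (rd * w)\<^sup>2 + (rb * y) * (rc * z) \<le> 2 * (F c d * (z * w))"
    using ineq(2) t yz unfolding roots by (simp add: power_mult_distrib mult_ac)
  have "8 * ((ra * x) * (rb * y) * (rc * z) * (rd * w))
     \<le> ((ra * x)\<^sup>2 + (rb * y)\<^sup>2 + (rb * y) * (rc * z)) * ((rc * z)\<^sup>2 + (rd * w)\<^sup>2 + (rb * y) * (rc * z))"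
    using roots pos by (intro four_variable_am_gm) auto
  also have "\<dots> \<le> (2 * (F a b * (x * y))) * (2 * (F c d * (z * w)))"
    using 1 2 roots pos by (intro mult_mono order_trans[OF _ 1] add_nonneg_nonneg) auto
  finally have "(2 * (ra * rb * rc * rd)) * (4 * (x * y * z * w)) \<le> (F a b * F c d) * (4 * (x * y * z * w))"
    by (simp add: mult_ac)
  thus ?thesis using pos by simp
qed

section \<open>Sections of a positive three-dimensional space\<close>

definition positive_on_span :: "'a set \<Rightarrow> ('a \<Rightarrow> 'a \<Rightarrow> real) \<Rightarrow> ('a \<Rightarrow> real) \<Rightarrow> ('a \<Rightarrow> real) \<Rightarrow> ('a \<Rightarrow> real) \<Rightarrow> bool" where
  "positive_on_span I F v1 v2 v3 \<longleftrightarrow> (\<forall>r s t. r \<noteq> 0 \<or> s \<noteq> 0 \<or> t \<noteq> 0 \<longrightarrow>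
     0 < form I F (\<lambda>i. r * v1 i + s * v2 i + t * v3 i) (\<lambda>i. r * v1 i + s * v2 i + t * v3 i))"

text \<open>
  A linear functional cuts the three-dimensional space in a subspace of dimension at least two.
\<close>

lemma positive_plane_in_kernel:
  assumes P: "positive_on_span I F v1 v2 v3"
  obtains u w where
    "\<And>s t. s \<noteq> 0 \<or> t \<noteq> 0 \<Longrightarrow> 0 < form I F (\<lambda>i. s * u i + t * w i) (\<lambda>i. s * u i + t * w i)"
    "\<And>s t. (\<Sum>i\<in>I. k i * (s * u i + t * w i)) = 0"
proof -
  define p where "p = (\<lambda>v. \<Sum>i\<in>I. k i * v i)"
  have p: "(\<Sum>i\<in>I. k i * (r * v1 i + s * v2 i + t * v3 i)) = r * p v1 + s * p v2 + t * p v3" for r s t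
    unfolding p_def by (simp add: sum_distrib_left sum.distrib algebra_simps)
  have "\<exists>a1 a2 a3 b1 b2 b3. a1 * p v1 + a2 * p v2 + a3 * p v3 = 0 \<and> b1 * p v1 + b2 * p v2 + b3 * p v3 = 0
      \<and> (\<forall>s t. s \<noteq> 0 \<or> t \<noteq> 0 \<longrightarrow> s * a1 + t * b1 \<noteq> 0 \<or> s * a2 + t * b2 \<noteq> 0 \<or> s * a3 + t * b3 \<noteq> 0)"
  proof (cases "p v1 = 0")
    case True
    show ?thesis
    proof (cases "p v2 = 0")
      case True
      thus ?thesis using \<open>p v1 = 0\<close>
        by - (rule exI[of _ 1], rule exI[of _ 0], rule exI[of _ 0], rule exI[of _ 0], rule exI[of _ 1], rule exI[of _ 0], auto)
    next
      case False
      thus ?thesis using \<open>p v1 = 0\<close>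
        by - (rule exI[of _ 1], rule exI[of _ 0], rule exI[of _ 0], rule exI[of _ 0], rule exI[of _ "p v3"], rule exI[of _ "- p v2"], auto)
    qed
  next
    case False
    thus ?thesis
      by - (rule exI[of _ "p v2"], rule exI[of _ "- p v1"], rule exI[of _ 0], rule exI[of _ "p v3"], rule exI[of _ 0], rule exI[of _ "- p v1"], auto)
  qed
  then obtain a1 a2 a3 b1 b2 b3 where ker: "a1 * p v1 + a2 * p v2 + a3 * p v3 = 0" "b1 * p v1 + b2 * p v2 + b3 * p v3 = 0"
    and ind: "\<And>s t. s \<noteq> 0 \<or> t \<noteq> 0 \<Longrightarrow> s * a1 + t * b1 \<noteq> 0 \<or> s * a2 + t * b2 \<noteq> 0 \<or> s * a3 + t * b3 \<noteq> 0"
    by (elim exE conjE) blast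
  define u w where "u = (\<lambda>i. a1 * v1 i + a2 * v2 i + a3 * v3 i)" and "w = (\<lambda>i. b1 * v1 i + b2 * v2 i + b3 * v3 i)"
  have comb: "s * u i + t * w i = (s * a1 + t * b1) * v1 i + (s * a2 + t * b2) * v2 i + (s * a3 + t * b3) * v3 i" for s t i
    unfolding u_def w_def by (simp add: algebra_simps)
  show thesis
  proof (rule that[of u w])
    fix s t :: real
    assume "s \<noteq> 0 \<or> t \<noteq> 0"
    from ind[OF this] show "0 < form I F (\<lambda>i. s * u i + t * w i) (\<lambda>i. s * u i + t * w i)"
      unfolding comb using P unfolding positive_on_span_def by blast
  next
    fix s t :: real
    have "(\<Sum>i\<in>I. k i * (s * u i + t * w i))
        = s * (a1 * p v1 + a2 * p v2 + a3 * p v3) + t * (b1 * p v1 + b2 * p v2 + b3 * p v3)"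
      unfolding comb p by (simp add: algebra_simps)
    thus "(\<Sum>i\<in>I. k i * (s * u i + t * w i)) = 0" using ker by simp
  qed
qed

lemma quartet_splits:
  assumes M: "sym_metzler I F" and I: "I = {a, b, c, d, e}" and dist: "distinct [a, b, c, d, e]"
    and P: "positive_on_span I F v1 v2 v3"
  shows "splits F a b c d \<or> splits F a c b d \<or> splits F a d b c"
proof -
  obtain u w where pos: "\<And>s t. s \<noteq> 0 \<or> t \<noteq> 0 \<Longrightarrow> 0 < form I F (\<lambda>i. s * u i + t * w i) (\<lambda>i. s * u i + t * w i)"
    and ker: "\<And>s t. (\<Sum>i\<in>I. (if i = e then 1 else 0) * (s * u i + t * w i)) = 0"
    using positive_plane_in_kernel[OF P, where k = "\<lambda>i. if i = e then 1 else 0"] by blast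
  have e: "s * u e + t * w e = 0" for s t using ker[of s t] dist unfolding I by simp
  have "form I F (\<lambda>i. s * u i + t * w i) (\<lambda>i. s * u i + t * w i)
      = form {a, b, c, d} F (\<lambda>i. s * u i + t * w i) (\<lambda>i. s * u i + t * w i)" for s t
  proof -
    have "I = insert e {a, b, c, d}" "e \<notin> {a, b, c, d}" using I dist by auto
    thus ?thesis by (simp only: form_def finite.intros sum.insert) (simp add: sum.distrib e)
  qed
  with pos have "\<And>s t. s \<noteq> 0 \<or> t \<noteq> 0 \<Longrightarrow>
    0 < form {a, b, c, d} F (\<lambda>i. s * u i + t * w i) (\<lambda>i. s * u i + t * w i)" by simp
  moreover have "sym_metzler {a, b, c, d} F" using M unfolding I sym_metzler_def by blast
  moreover have "distinct [a, b, c, d]" using dist by simp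
  ultimately show ?thesis by (intro positive_plane_splits)
qed

text \<open>
  The matrix with diagonal \<open>p, q\<close> and off-diagonal entry \<open>m\<close> has signature \<open>(1, 1)\<close>. For such forms the
  Cauchy-Schwarz inequality is reversed on vectors of positive value. It is applied here to \<open>(x, y)\<close> and to
  the solution of the linear system with right-hand side \<open>(g, h)\<close>.
\<close>

lemma reverse_cauchy_schwarz:
  fixes p q m x y g h :: real
  assumes "p * q < m\<^sup>2" "0 \<le> x * g + y * h" 
    and a: "x * g + y * h < p * x\<^sup>2 + q * y\<^sup>2 + 2 * m * x * y" and b: "x * g + y * h < B"
  shows "(- q * g\<^sup>2 + 2 * m * g * h - p * h\<^sup>2) / (m\<^sup>2 - p * q) < B"
proof -
  define k A Q D where "k = x * g + y * h" and "A = p * x\<^sup>2 + q * y\<^sup>2 + 2 * m * x * y"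
    and "Q = - q * g\<^sup>2 + 2 * m * g * h - p * h\<^sup>2" and "D = m\<^sup>2 - p * q"
  have D: "0 < D" using assms by (simp add: D_def)
  have k: "0 \<le> k" "k < A" "k < B" using assms by (auto simp: k_def A_def)
  have "D * k\<^sup>2 - A * Q = (y * (- q * g + m * h) - x * (m * g - p * h))\<^sup>2"
    unfolding D_def k_def A_def Q_def by (simp add: power2_eq_square algebra_simps)
  hence "A * Q \<le> D * k\<^sup>2" using zero_le_power2[of "y * (- q * g + m * h) - x * (m * g - p * h)"] by linarith
  also have "\<dots> = k * (D * k)" by (simp add: power2_eq_square)
  also have "\<dots> \<le> A * (D * k)" using k D by (intro mult_right_mono) auto
  finally have "Q \<le> D * k" using k by simp
  also have "\<dots> < D * B" using k D by simp
  finally show ?thesis unfolding Q_def[symmetric] D_def[symmetric] using D by (simp add: field_simps)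
qed

text \<open>
  The denominator is the negated determinant of the block of \<open>a\<close> and \<open>b\<close>; it is positive for an edge of a
  split pair.
\<close>

definition schur_complement :: "('a \<Rightarrow> 'a \<Rightarrow> real) \<Rightarrow> 'a \<Rightarrow> 'a \<Rightarrow> 'a \<Rightarrow> 'a \<Rightarrow> real" where
  "schur_complement F a b i j = F i j - (- F b b * F a i * F a j + F a b * (F a i * F b j + F b i * F a j) - F a a * F b i * F b j)
     / ((F a b)\<^sup>2 - F a a * F b b)"

text \<open>
  By the reversed Cauchy-Schwarz inequality, eliminating \<open>a\<close> and \<open>b\<close> leaves a positive value at the vector
  \<open>(z, w)\<close> of the split. Elimination makes the diagonal only more negative, so the positive value is due
  to the off-diagonal entry.
\<close>

lemma schur_complement_pos:
  assumes M: "sym_metzler I F" and sub: "{a, b, c, d} \<subseteq> I" and dist: "distinct [a, b, c, d]"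
    and s: "splits F a b c d"
  shows "0 < schur_complement F a b c d"
proof -
  obtain x y z w where pos: "0 < x" "0 < y" "0 < z" "0 < w" and
    ineq: "F a c * x * z + F a d * x * w + F b c * y * z + F b d * y * w
       < F a a * x\<^sup>2 + F b b * y\<^sup>2 + 2 * F a b * x * y"
      "F a c * x * z + F a d * x * w + F b c * y * z + F b d * y * w
       < F c c * z\<^sup>2 + F d d * w\<^sup>2 + 2 * F c d * z * w"
    using s by (rule splitsE)
  have cross: "0 \<le> F a c" "0 \<le> F a d" "0 \<le> F b c" "0 \<le> F b d" "0 \<le> F a b"
    and diag: "F a a < 0" "F b b < 0" "F c c < 0" "F d d < 0"
    using sym_metzlerD[OF M] sub dist by auto
  define D where "D = (F a b)\<^sup>2 - F a a * F b b"
  have D: "0 < D" using splits_edge[OF assms] by (simp add: D_def)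
  define g h where "g = F a c * z + F a d * w" and "h = F b c * z + F b d * w"
  have k: "x * g + y * h = F a c * x * z + F a d * x * w + F b c * y * z + F b d * y * w"
    unfolding g_def h_def by (simp add: algebra_simps)
  have "(- F b b * g\<^sup>2 + 2 * F a b * g * h - F a a * h\<^sup>2) / D < F c c * z\<^sup>2 + F d d * w\<^sup>2 + 2 * F c d * z * w"
    unfolding D_def
  proof (rule reverse_cauchy_schwarz[of _ _ _ x _ y])
    show "F a a * F b b < (F a b)\<^sup>2" using splits_edge[OF assms] by simp
    show "0 \<le> x * g + y * h" unfolding k using pos cross by (intro add_nonneg_nonneg mult_nonneg_nonneg) auto
  qed (use ineq k in auto)
  hence "0 < (F c c * z\<^sup>2 + F d d * w\<^sup>2 + 2 * F c d * z * w) * D - (- F b b * g\<^sup>2 + 2 * F a b * g * h - F a a * h\<^sup>2)"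
    using D by (simp add: field_simps)
  also have "\<dots> = (F c c * D - (- F b b * (F a c)\<^sup>2 + 2 * F a b * F a c * F b c - F a a * (F b c)\<^sup>2)) * z\<^sup>2
      + (F d d * D - (- F b b * (F a d)\<^sup>2 + 2 * F a b * F a d * F b d - F a a * (F b d)\<^sup>2)) * w\<^sup>2
      + 2 * (F c d * D - (- F b b * F a c * F a d + F a b * (F a c * F b d + F b c * F a d) - F a a * F b c * F b d)) * (z * w)"
    unfolding g_def h_def by (simp add: power2_eq_square algebra_simps)
  also have "\<dots> \<le> 0 + 0 + 2 * (F c d * D - (- F b b * F a c * F a d + F a b * (F a c * F b d + F b c * F a d) - F a a * F b c * F b d)) * (z * w)"
  proof -
    have neg: "(r * D - (- F b b * p\<^sup>2 + 2 * F a b * p * q - F a a * q\<^sup>2)) * t\<^sup>2 \<le> 0" if "r < 0" "0 \<le> p" "0 \<le> q" for r p q t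
    proof -
      have "r * D \<le> 0" using that D by (simp add: mult_nonpos_nonneg)
      moreover have "0 \<le> - F b b * p\<^sup>2" "0 \<le> - F a a * q\<^sup>2" "0 \<le> 2 * F a b * p * q"
        using diag cross that by (simp_all add: mult_nonpos_nonneg)
      ultimately show ?thesis by (intro mult_nonpos_nonneg) (linarith, simp)
    qed
    show ?thesis using neg[of "F c c" "F a c" "F b c" z] neg[of "F d d" "F a d" "F b d" w] diag cross by linarith
  qed
  finally have "0 < (2 * (F c d * D - (- F b b * F a c * F a d + F a b * (F a c * F b d + F b c * F a d) - F a a * F b c * F b d))) * (z * w)" by simp
  moreover have "0 < z * w" using pos by simp
  ultimately have "0 < 2 * (F c d * D - (- F b b * F a c * F a d + F a b * (F a c * F b d + F b c * F a d) - F a a * F b c * F b d))" by (rule zero_less_mult_pos2)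
  hence "0 < (F c d * D - (- F b b * F a c * F a d + F a b * (F a c * F b d + F b c * F a d) - F a a * F b c * F b d))" by simp
  moreover have "schur_complement F a b c d = (F c d * D - (- F b b * F a c * F a d + F a b * (F a c * F b d + F b c * F a d) - F a a * F b c * F b d)) / D"
    unfolding schur_complement_def D_def[symmetric] using D by (simp add: diff_divide_distrib)
  ultimately show ?thesis using D by simp
qed

text \<open>
  The third assumption says that the derivative with respect to \<open>y\<close> vanishes after \<open>x\<close> has been eliminated.
  Of the two squares that the elimination of \<open>x\<close> and \<open>y\<close> splits off, the one with positive coefficient then
  disappears.
\<close>

lemma complete_squares:
  fixes p q m x y g h R :: real
  assumes "p < 0" "p * q < m\<^sup>2" "(m\<^sup>2 - p * q) * y + m * g - p * h = 0"
  shows "p * x\<^sup>2 + q * y\<^sup>2 + 2 * m * x * y + 2 * x * g + 2 * y * h + R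
    \<le> R - (- q * g\<^sup>2 + 2 * m * g * h - p * h\<^sup>2) / (m\<^sup>2 - p * q)"
proof -
  define D where "D = m\<^sup>2 - p * q"
  have D: "0 < D" using assms by (simp add: D_def)
  define L X where "L = D * y\<^sup>2 + 2 * y * (m * g - p * h)" and "X = - q * g\<^sup>2 + 2 * m * g * h - p * h\<^sup>2"
  have "D * L = (D * y)\<^sup>2 + 2 * (D * y) * (m * g - p * h)"
    unfolding L_def by (simp add: power2_eq_square algebra_simps)
  also have "D * y = - (m * g - p * h)" using assms(3) unfolding D_def by simp
  finally have "D * (L + g\<^sup>2) = p * X"
    unfolding X_def by (simp add: D_def power2_eq_square algebra_simps)
  hence "(L + g\<^sup>2) / p = X / D" using D assms(1) by (simp add: field_simps)
  moreover have "(p * x + m * y + g)\<^sup>2 / p \<le> 0" using assms(1) by (simp add: divide_nonneg_neg)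
  moreover have "p * x\<^sup>2 + q * y\<^sup>2 + 2 * m * x * y + 2 * x * g + 2 * y * h
     = (p * x + m * y + g)\<^sup>2 / p - (L + g\<^sup>2) / p"
    using assms(1) unfolding L_def D_def by (simp add: field_simps power2_eq_square)
  ultimately show ?thesis unfolding D_def[symmetric] X_def[symmetric] by linarith
qed

lemma schur_complement_form:
  fixes u :: "'a \<Rightarrow> real"
  assumes M: "sym_metzler I F" and I: "I = insert a (insert b J)" and J: "finite J" "a \<noteq> b" "a \<notin> J" "b \<notin> J"
  shows "form I F u u = F a a * (u a)\<^sup>2 + F b b * (u b)\<^sup>2 + 2 * F a b * u a * u b
     + 2 * u a * (\<Sum>i\<in>J. F a i * u i) + 2 * u b * (\<Sum>i\<in>J. F b i * u i) + form J F u u" (is ?full)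
    and "form J (schur_complement F a b) u u = form J F u u
     - (- F b b * (\<Sum>i\<in>J. F a i * u i)\<^sup>2 + 2 * F a b * (\<Sum>i\<in>J. F a i * u i) * (\<Sum>i\<in>J. F b i * u i)
        - F a a * (\<Sum>i\<in>J. F b i * u i)\<^sup>2) / ((F a b)\<^sup>2 - F a a * F b b)" (is ?schur_complement)
proof -
  define g h where "g = (\<Sum>i\<in>J. F a i * u i)" and "h = (\<Sum>i\<in>J. F b i * u i)"
  have sym: "F i a = F a i" "F i b = F b i" if "i \<in> I" for i
    using sym_metzlerD(2)[OF M] that I by auto
  have col: "(\<Sum>i\<in>J. F i a * u i * u a) = u a * g" "(\<Sum>i\<in>J. F i b * u i * u b) = u b * h"
    unfolding g_def h_def sum_distrib_left using sym I by (intro sum.cong; simp)+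
  have row: "(\<Sum>j\<in>J. F a j * u a * u j) = u a * g" "(\<Sum>j\<in>J. F b j * u b * u j) = u b * h"
    unfolding g_def h_def sum_distrib_left by (auto intro!: sum.cong)
  have ba: "F b a = F a b" using sym(1)[of b] I by simp
  have "form I F u u = F a a * u a * u a + F a b * u a * u b + u a * g
      + (F b a * u b * u a + F b b * u b * u b + u b * h)
      + (u a * g + u b * h + form J F u u)"
    unfolding form_def I using J by (simp add: sum.distrib col row)
  thus ?full unfolding g_def[symmetric] h_def[symmetric] ba by (simp add: power2_eq_square algebra_simps)
  define D where "D = (F a b)\<^sup>2 - F a a * F b b"
  have prod: "(\<Sum>i\<in>J. \<Sum>j\<in>J. (p i * u i) * (q j * u j)) = (\<Sum>i\<in>J. p i * u i) * (\<Sum>j\<in>J. q j * u j)" for p q :: "'a \<Rightarrow> real"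
    by (simp add: sum_product)
  have "form J (schur_complement F a b) u u = (\<Sum>i\<in>J. \<Sum>j\<in>J. F i j * u i * u j
      - (- F b b * ((F a i * u i) * (F a j * u j)) + F a b * ((F a i * u i) * (F b j * u j) + (F b i * u i) * (F a j * u j))
         - F a a * ((F b i * u i) * (F b j * u j))) / D)"
    unfolding form_def schur_complement_def D_def[symmetric]
    by (intro sum.cong refl) (simp add: diff_divide_distrib add_divide_distrib algebra_simps)
  also have "\<dots> = form J F u u - (- F b b * (g * g) + F a b * (g * h + h * g) - F a a * (h * h)) / D"
    unfolding form_def g_def h_def prod[symmetric]
    by (simp add: sum_subtractf sum.distrib sum_divide_distrib[symmetric] sum_distrib_left[symmetric] sum_negf)
  finally show ?schur_complement unfolding g_def[symmetric] h_def[symmetric] D_def[symmetric]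
    by (simp add: power2_eq_square algebra_simps)
qed

text \<open>
  The Schur complement of the edge would be positive on a plane, have a negative diagonal and, by
  \<open>schur_complement_pos\<close>, positive off-diagonal entries, although only three indices are left.
\<close>

lemma no_edge_in_three_splits:
  assumes M: "sym_metzler I F" and I: "I = {a, b, c, d, e}" and dist: "distinct [a, b, c, d, e]"
    and P: "positive_on_span I F v1 v2 v3"
    and s: "splits F a b c d" "splits F a b c e" "splits F a b d e"
  shows False
proof -
  let ?J = "{c, d, e}"
  \<comment> \<open>on the kernel of this functional \<open>v b\<close> is the stationary value given \<open>v c\<close>, \<open>v d\<close>, \<open>v e\<close>\<close>
  let ?k = "\<lambda>i. if i = a then 0 else if i = b then (F a b)\<^sup>2 - F a a * F b b else F a b * F a i - F a a * F b i"
  obtain u w where pos: "\<And>s t. s \<noteq> 0 \<or> t \<noteq> 0 \<Longrightarrow> 0 < form I F (\<lambda>i. s * u i + t * w i) (\<lambda>i. s * u i + t * w i)"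
    and ker: "\<And>s t. (\<Sum>i\<in>I. ?k i * (s * u i + t * w i)) = 0"
    using positive_plane_in_kernel[OF P, where k = ?k] by blast
  have I': "I = insert a (insert b ?J)" "finite ?J" "a \<noteq> b" "a \<notin> ?J" "b \<notin> ?J" using I dist by auto
  have edge: "F a a * F b b < (F a b)\<^sup>2"
    by (rule splits_edge[OF M _ _ s(1)]) (use I dist in auto)
  have diag: "F a a < 0" "F b b < 0" using sym_metzlerD[OF M] I by auto
  have le: "form I F v v \<le> form ?J (schur_complement F a b) v v" if "(\<Sum>i\<in>I. ?k i * v i) = 0" for v
  proof -
    have "(\<Sum>i\<in>?J. ?k i * v i) = (\<Sum>i\<in>?J. (F a b * F a i - F a a * F b i) * v i)"
      using I'(4,5) by (intro sum.cong) auto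
    also have "\<dots> = F a b * (\<Sum>i\<in>?J. F a i * v i) - F a a * (\<Sum>i\<in>?J. F b i * v i)"
      unfolding sum_distrib_left sum_subtractf[symmetric] by (intro sum.cong) (auto simp: algebra_simps)
    finally have "((F a b)\<^sup>2 - F a a * F b b) * v b + F a b * (\<Sum>i\<in>?J. F a i * v i) - F a a * (\<Sum>i\<in>?J. F b i * v i) = 0"
      using that unfolding I'(1) using I'(2-5) by (simp del: sum.insert add: sum.insert[of _ a] sum.insert[of _ b])
    from complete_squares[OF diag(1) edge this]
    show ?thesis unfolding schur_complement_form[OF M I'] .
  qed
  have sub: "{a, b, c, d} \<subseteq> I" "{a, b, c, e} \<subseteq> I" "{a, b, d, e} \<subseteq> I" using I by auto
  have off: "0 < schur_complement F a b c d" "0 < schur_complement F a b c e" "0 < schur_complement F a b d e"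
    using schur_complement_pos[OF M sub(1) _ s(1)] schur_complement_pos[OF M sub(2) _ s(2)] schur_complement_pos[OF M sub(3) _ s(3)] dist by auto
  have sym: "schur_complement F a b i j = schur_complement F a b j i" if "i \<in> I" "j \<in> I" for i j
    using sym_metzlerD(2)[OF M that] unfolding schur_complement_def by (simp add: algebra_simps)
  have "schur_complement F a b i i < 0" if "i \<in> ?J" for i
  proof -
    have "a \<in> I" "b \<in> I" "i \<in> I" "a \<noteq> i" "b \<noteq> i" using that I' by auto
    with I'(3) have "0 \<le> F a i" "0 \<le> F b i" "0 \<le> F a b" "F i i < 0"
      using sym_metzlerD(1)[OF M] sym_metzlerD(3)[OF M] by blast+
    moreover from this have "0 \<le> - F b b * F a i * F a i" "0 \<le> - F a a * F b i * F b i" "0 \<le> F a b * (F a i * F b i + F b i * F a i)"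
      using diag by (simp_all add: mult_nonpos_nonneg)
    ultimately show ?thesis unfolding schur_complement_def using edge
      by (smt (verit, best) divide_nonneg_pos mult_minus_left)
  qed
  hence "sym_metzler ?J (schur_complement F a b)"
    using off sym[of c d] sym[of c e] sym[of d e] I unfolding sym_metzler_def by auto
  thus False
  proof (rule no_positive_plane_3)
    fix s t :: real
    assume "s \<noteq> 0 \<or> t \<noteq> 0"
    from pos[OF this] le[OF ker[of s t]]
    show "0 < form ?J (schur_complement F a b) (\<lambda>i. s * u i + t * w i) (\<lambda>i. s * u i + t * w i)" by linarith
  qed
qed

section \<open>The pentagon of split pairs\<close>

lemma cancel_exchange:
  fixes A B C D E G :: real
  assumes "C * D < A * B" "A * G < E * D" "0 < A" "0 < D" "0 \<le> C" "0 \<le> G"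
  shows "C * G < B * E"
proof -
  have "(C * D) * (A * G) < (A * B) * (E * D)"
    using assms by (intro mult_strict_mono'[OF assms(1,2)]) auto
  hence "(C * G) * (A * D) < (B * E) * (A * D)" by (simp only: mult_ac)
  thus ?thesis using assms by simp
qed

text \<open>
  The pentagon \<open>a b c d e\<close> without a vertex is a path, and the first and last edge of that path form the
  split of the remaining quartet.
\<close>

definition split_pentagon :: "('a \<Rightarrow> 'a \<Rightarrow> real) \<Rightarrow> 'a \<Rightarrow> 'a \<Rightarrow> 'a \<Rightarrow> 'a \<Rightarrow> 'a \<Rightarrow> bool" where
  "split_pentagon F a b c d e \<longleftrightarrow> splits F a b c d \<and> splits F b c d e \<and> splits F c d e a \<and> splits F d e a b \<and> splits F e a b c"

text \<open>
  The edges of the two given splits form the path \<open>d c b a e\<close>, which the edge \<open>e d\<close> closes to the pentagon.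
\<close>

lemma split_pentagon_of_path:
  assumes M: "sym_metzler I F" and I: "I = {a, b, c, d, e}" and dist: "distinct [a, b, c, d, e]"
    and P: "positive_on_span I F v1 v2 v3"
    and S5: "splits F a b c d" and S4: "splits F a e b c"
  shows "split_pentagon F a b c d e"
proof -
  have quartets: "splits F p q r s \<or> splits F p r q s \<or> splits F p s q r"
    if "I = {p, q, r, s, t}" "distinct [p, q, r, s, t]" for p q r s t
    by (rule quartet_splits[OF M that P])
  have triple: False
    if "I = {p, q, r, s, t}" "distinct [p, q, r, s, t]" "splits F p q r s" "splits F p q r t" "splits F p q s t"
    for p q r s t
    by (rule no_edge_in_three_splits[OF M that(1,2) P that(3-5)])
  have ne: "a \<noteq> b" "a \<noteq> c" "a \<noteq> d" "a \<noteq> e" "b \<noteq> c" "b \<noteq> d" "b \<noteq> e" "c \<noteq> d" "c \<noteq> e" "d \<noteq> e"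
    using dist by auto
  have swap: "splits F q p r s" "splits F p q s r" "splits F r s p q"
    if "splits F p q r s" "p \<in> I" "q \<in> I" "r \<in> I" "s \<in> I" for p q r s
    using splits_sym[OF M _ that(1)] that by auto
  have mem: "a \<in> I" "b \<in> I" "c \<in> I" "d \<in> I" "e \<in> I" using I by auto
  note nn = sym_metzlerD(3)[OF M mem(1,2) ne(1)] sym_metzlerD(3)[OF M mem(1,3) ne(2)] sym_metzlerD(3)[OF M mem(1,4) ne(3)]
    sym_metzlerD(3)[OF M mem(1,5) ne(4)] sym_metzlerD(3)[OF M mem(2,3) ne(5)] sym_metzlerD(3)[OF M mem(2,4) ne(6)]
    sym_metzlerD(3)[OF M mem(2,5) ne(7)] sym_metzlerD(3)[OF M mem(3,4) ne(8)] sym_metzlerD(3)[OF M mem(3,5) ne(9)]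
  note flip = sym_metzlerD(2)[OF M mem(5,3)] sym_metzlerD(2)[OF M mem(5,2)] sym_metzlerD(2)[OF M mem(4,3)]
    sym_metzlerD(2)[OF M mem(4,2)] sym_metzlerD(2)[OF M mem(5,4)]
  have dom: "F p r * F q s < F p q * F r s" "F p s * F q r < F p q * F r s" "0 < F p q" "0 < F r s"
    if "splits F p q r s" "distinct [p, q, r, s]" "p \<in> I" "q \<in> I" "r \<in> I" "s \<in> I" for p q r s
  proof -
    have sub: "{p, q, r, s} \<subseteq> I" "{r, s, p, q} \<subseteq> I" and d: "distinct [r, s, p, q]" using that by auto
    show "F p r * F q s < F p q * F r s" "F p s * F q r < F p q * F r s"
      using splits_dominates[OF M sub(1) that(2,1)] .
    show "0 < F p q" using splits_edge[OF M sub(1) that(2,1)] by simp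
    show "0 < F r s" using splits_edge(1)[OF M sub(2) d swap(3)[OF that(1,3-6)]] .
  qed
  note D5 = dom[OF S5 _ mem(1,2,3,4)] and D4 = dom[OF S4 _ mem(1,5,2,3)]
  have d5: "F a c * F b d < F a b * F c d" "F a d * F b c < F a b * F c d" "0 < F a b" "0 < F c d"
    using D5 ne by simp_all
  have d4: "F a b * F c e < F a e * F b c" "F a c * F b e < F a e * F b c" "0 < F a e" "0 < F b c"
    using D4 ne flip by simp_all
  have D1: "F a d * F c e < F c d * F a e"
    by (rule cancel_exchange[where A = "F a b" and D = "F b c"]) (use d5 d4 nn in \<open>simp_all only: mult.commute\<close>)
  \<comment> \<open>Three quartets are still free; all choices except the pentagon contradict each other by
    multiplying dominance inequalities, or use one edge three times.\<close>
  have Q2: "splits F a c d e \<or> splits F a d c e \<or> splits F a e c d"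
    by (rule quartets[of a c d e b]) (use ne in \<open>auto simp: I\<close>)
  have Q1: "splits F b c d e \<or> splits F b d c e \<or> splits F b e c d"
    by (rule quartets[of b c d e a]) (use ne in \<open>auto simp: I\<close>)
  have Q3: "splits F a b d e \<or> splits F a d b e \<or> splits F a e b d"
    by (rule quartets[of a b d e c]) (use ne in \<open>auto simp: I\<close>)
  have X1: "\<not> splits F a d c e"
    using D1 dom(2)[of a d c e] mem ne flip by (auto simp: mult.commute)
  have X23: False if S: "splits F b d c e" and T: "splits F a d b e \<or> splits F a b d e"
  proof -
    have s: "F b c * F d e < F b d * F c e" "F b e * F c d < F b d * F c e" "0 < F b d" "0 < F c e"
      using dom[OF S] mem ne flip by (simp_all add: mult.commute)
    from T show False
    proof
      assume "splits F a d b e"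
      from dom[OF this] have t: "F b d * F a e < F a d * F b e" "0 < F b e"
        using mem ne flip by (simp_all add: mult.commute)
      have "F c d * F a e < F c e * F a d"
        by (rule cancel_exchange[where A = "F b d" and D = "F b e"]) (use s t nn in \<open>simp_all only: mult.commute\<close>)
      thus False using D1 by (simp add: mult.commute)
    next
      assume "splits F a b d e"
      from dom[OF this] have t: "F b d * F a e < F a b * F d e" "0 < F d e"
        using mem ne flip by (simp_all add: mult.commute)
      have "F b c * F a e < F c e * F a b"
        by (rule cancel_exchange[where A = "F b d" and D = "F d e"]) (use s t nn in \<open>simp_all only: mult.commute\<close>)
      thus False using d4 by (simp add: mult.commute)
    qed
  qed
  have X4: False if S: "splits F a d b e" and T: "splits F b c d e"
  proof -
    have s: "F a b * F d e < F b e * F a d" "0 < F b e"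
      using dom[OF S] mem ne flip by (simp_all add: mult.commute)
    have t: "F b e * F c d < F b c * F d e" "0 < F d e"
      using dom[OF T] mem ne flip by (simp_all add: mult.commute)
    have "F a b * F c d < F a d * F b c"
      by (rule cancel_exchange[where A = "F b e" and D = "F d e"]) (use s t nn in \<open>simp_all only: mult.commute\<close>)
    thus False using d5 by simp
  qed
  have X5: "\<not> splits F b e c d" "\<not> splits F a e b d" if S: "splits F a c d e"
  proof -
    have s: "F c d * F a e < F d e * F a c" "F a e * F c d < F d e * F a c" "0 < F a c" "0 < F d e"
      using dom[OF S] mem ne flip by (simp_all add: mult.commute)
    show "\<not> splits F a e b d"
    proof
      assume "splits F a e b d"
      from dom[OF this] have "F a b * F d e < F a e * F b d" using mem ne flip by (simp_all add: mult.commute)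
      moreover have "F b d * F a e < F a b * F d e"
        by (rule cancel_exchange[where A = "F c d" and D = "F a c"]) (use s d5 nn in \<open>simp_all only: mult.commute\<close>)
      ultimately show False by (simp add: mult.commute)
    qed
    show "\<not> splits F b e c d"
    proof
      assume "splits F b e c d"
      from dom[OF this] have "F b c * F d e < F b e * F c d" using mem ne flip by (simp_all add: mult.commute)
      moreover have "F b e * F c d < F b c * F d e"
        by (rule cancel_exchange[where A = "F a e" and D = "F a c"]) (use s d4 nn in \<open>simp_all only: mult.commute\<close>)
      ultimately show False by simp
    qed
  qed
  from Q2 X1 consider "splits F a c d e" | "splits F a e c d" by blast
  thus ?thesis
  proof cases
    case 1
    have False if "splits F b c d e" "splits F a b d e"
    proof -
      have "splits F d e b c" "splits F d e a b" "splits F d e a c"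
        using swap(3)[OF that(1)] swap(3)[OF that(2)] swap(3)[OF 1] mem by blast+
      moreover have "I = {d, e, a, b, c}" "distinct [d, e, a, b, c]" using ne by (auto simp: I)
      ultimately show False using triple by blast
    qed
    thus ?thesis using Q1 Q3 X23 X4 X5[OF 1] by blast
  next
    case 2
    have "\<not> splits F b e c d"
    proof
      assume "splits F b e c d"
      hence "splits F c d b e" "splits F c d a e" "splits F c d a b"
        using swap(3) 2 S5 mem by blast+
      moreover have "I = {c, d, a, b, e}" "distinct [c, d, a, b, e]" using ne by (auto simp: I)
      ultimately show False using triple by blast
    qed
    moreover have "I = {a, e, b, c, d}" "distinct [a, e, b, c, d]" using ne by (auto simp: I)
    hence "\<not> splits F a e b d" using triple 2 S4 by blast
    ultimately have S1: "splits F b c d e" and S3: "splits F a b d e"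
      using Q1 Q3 X23 X4 by blast+
    have "splits F c d e a" using 2 swap mem by blast
    moreover have "splits F d e a b" using S3 swap(3) mem by blast
    moreover have "splits F e a b c" using S4 swap(1) mem by blast
    ultimately show ?thesis using S5 S1 unfolding split_pentagon_def by blast
  qed
qed

lemma ex_split_pentagon:
  assumes M: "sym_metzler I F" and I: "I = {a, b, c, d, e}" and dist: "distinct [a, b, c, d, e]"
    and P: "positive_on_span I F v1 v2 v3"
  shows "\<exists>a b c d e. I = {a, b, c, d, e} \<and> distinct [a, b, c, d, e] \<and> split_pentagon F a b c d e"
proof -
  have quartets: "splits F p q r s \<or> splits F p r q s \<or> splits F p s q r"
    if "I = {p, q, r, s, t}" "distinct [p, q, r, s, t]" for p q r s t
    by (rule quartet_splits[OF M that P])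
  have triple: False
    if "I = {p, q, r, s, t}" "distinct [p, q, r, s, t]" "splits F p q r s" "splits F p q r t" "splits F p q s t"
    for p q r s t
    by (rule no_edge_in_three_splits[OF M that(1,2) P that(3-5)])
  note path = split_pentagon_of_path[OF M _ _ P]
  have swap: "splits F q p r s" "splits F p q s r" "splits F r s p q"
    if "splits F p q r s" "p \<in> I" "q \<in> I" "r \<in> I" "s \<in> I" for p q r s
    using splits_sym[OF M _ that(1)] that by auto
  \<comment> \<open>If \<open>p q\<close> is used for \<open>{p, q, r, s}\<close> but not for \<open>{p, q, r, t}\<close>, the split of the latter joins
    \<open>r\<close> to \<open>q\<close> or to \<open>p\<close>, which is the configuration that completes to a pentagon.\<close>
  have start: ?thesis if pI: "I = {p, q, r, s, t}" and pd: "distinct [p, q, r, s, t]" and 1: "splits F p q r s"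
    and 2: "\<not> splits F p q r t" for p q r s t
  proof -
    have mem: "p \<in> I" "q \<in> I" "r \<in> I" "s \<in> I" "t \<in> I" using pI by auto
    have "splits F p r q t \<or> splits F p t q r"
      using quartets[of p q r t s] pI pd 2 by (auto simp: insert_commute)
    thus ?thesis
    proof
      assume "splits F p t q r"
      thus ?thesis using path[OF pI pd 1] pI pd by blast
    next
      assume "splits F p r q t"
      hence "splits F q t p r" using swap(3) mem by blast
      moreover have "splits F q p r s" using swap(1)[OF 1] mem by blast
      moreover have "I = {q, p, r, s, t}" "distinct [q, p, r, s, t]" using pI pd by auto
      ultimately show ?thesis using path by blast
    qed
  qed
  obtain p q r s t where p: "I = {p, q, r, s, t}" "distinct [p, q, r, s, t]" "splits F p q r s"
  proof -
    have "I = {a, c, b, d, e}" "distinct [a, c, b, d, e]" "I = {a, d, b, c, e}" "distinct [a, d, b, c, e]"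
      using I dist by auto
    thus ?thesis using quartets[OF I dist] that I dist by blast
  qed
  show ?thesis
  proof (cases "splits F p q r t")
    case False
    show ?thesis by (rule start[OF p False])
  next
    case True
    have "\<not> splits F p q s t" using triple[OF p True] by blast
    moreover have "splits F p q s r" using swap(2)[OF p(3)] p(1) by auto
    moreover have "I = {p, q, s, r, t}" "distinct [p, q, s, r, t]" using p by auto
    ultimately show ?thesis by (intro start)
  qed
qed

section \<open>Test vector estimate for a weighted pentagon\<close>

text \<open>
  Here \<open>d i\<close> is \<open>1 - e i\<close> in \<open>pentagon_cycle_bound\<close>. At \<open>d1 = 1\<close> both sides equal \<open>12\<close>: this is the
  degenerate case of a path with eigenvalue exactly \<open>2\<close>, and the inequality is tight there.
\<close>

lemma pentagon_quadratic_inequality: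
  fixes d1 d2 d3 d4 d5 \<delta> :: real
  assumes sum: "d1 + d2 + d3 + d4 + d5 = 1"
    and lo: "\<delta> \<le> d2" "\<delta> \<le> d3" "\<delta> \<le> d4" "\<delta> \<le> d5" and \<delta>: "0 \<le> \<delta>"
    and hi: "d2 \<le> d1" "d3 \<le> d1" "d4 \<le> d1" "d5 \<le> d1"
  shows "(1 - d1) * (2 - d1) + (1 - d2) * (2 - d2) + (1 - d5) * (2 - d5)
           + 2 * ((1 - d3) * (2 - d3)) + 2 * ((1 - d4) * (2 - d4)) + 7 / 4 * \<delta>\<^sup>2
         \<le> (40 * (d1 + (d2 + d3) * (d4 + d5)) + 16) / 7 + 4 * ((1 - d3) * (1 - d4))
           + 13 / 4 * ((1 - d1) * (2 - d2 - d5))" (is "?l \<le> ?r")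
proof -
  have d: "0 \<le> d2" "0 \<le> d3" "0 \<le> d4" "0 \<le> d5" using lo \<delta> by auto
  have d1: "d1 = 1 - d2 - d3 - d4 - d5" using sum by simp
  have "\<delta>\<^sup>2 \<le> d2 * d5" using lo \<delta> by (simp add: power2_eq_square mult_mono)
  \<comment> \<open>The products \<open>d * (d1 - d)\<close> absorb the linear terms; what is left has two positive definite
    binary forms and cross terms with positive coefficients.\<close>
  moreover have "?r - ?l + 7 / 4 * \<delta>\<^sup>2 = 
      39 / 14 * (d2 * (d1 - d2)) + 39 / 14 * (d5 * (d1 - d5))
      + 25 / 14 * (d3 * (d1 - d3)) + 25 / 14 * (d4 * (d1 - d4))
      + 9 / 28 * (d2 - 19 / 18 * d3)\<^sup>2 + 215 / 1008 * d3\<^sup>2 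
      + 9 / 28 * (d5 - 19 / 18 * d4)\<^sup>2 + 215 / 1008 * d4\<^sup>2
      + 39 / 14 * (d2 * d5) + 79 / 7 * (d3 * d4) + 141 / 28 * (d2 * d4) + 141 / 28 * (d3 * d5)"
    unfolding d1 by (simp add: field_simps power2_eq_square)
  moreover have "0 \<le> d2 * (d1 - d2)" "0 \<le> d5 * (d1 - d5)" "0 \<le> d3 * (d1 - d3)" "0 \<le> d4 * (d1 - d4)"
    "0 \<le> d2 * d5" "0 \<le> d3 * d4" "0 \<le> d2 * d4" "0 \<le> d3 * d5"
    using d hi by auto
  moreover have "0 \<le> (d2 - 19 / 18 * d3)\<^sup>2" "0 \<le> d3\<^sup>2" "0 \<le> (d5 - 19 / 18 * d4)\<^sup>2" "0 \<le> d4\<^sup>2" by auto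
  ultimately show ?thesis by linarith
qed

lemma weighted_am_gm:
  fixes a b p s c :: real
  assumes "0 \<le> a" "0 \<le> b" "0 \<le> p" "0 \<le> s" "c \<le> p * s"
  shows "2 * sqrt (c * (a * b)) \<le> a * p + b * s"
proof -
  have "c * (a * b) \<le> (p * s) * (a * b)"
    using assms by (intro mult_right_mono) auto
  hence "sqrt (c * (a * b)) \<le> sqrt ((a * p) * (b * s))"
    by (simp add: mult_ac)
  also have "\<dots> \<le> (a * p + b * s) / 2"
    using assms by (intro arith_geo_mean_sqrt) auto
  finally show ?thesis by simp
qed

text \<open>
  A concave function lies above the chord between \<open>4 / 25\<close> and \<open>1\<close>. The chord is steep enough to keep the
  estimate tight at \<open>u = 1\<close>, and the product it is used for is at least \<open>1 / 5\<close>.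
\<close>

lemma sqrt_chord:
  fixes u :: real
  assumes "(2 / 5)\<^sup>2 \<le> u" "u \<le> 1"
  shows "(5 * u + 2) / 7 \<le> sqrt u"
proof -
  have "2 / 5 \<le> sqrt u" "sqrt u \<le> 1" using assms real_le_rsqrt[of "2/5" u] by auto
  hence "0 \<le> (sqrt u - 2 / 5) * (1 - sqrt u)" by auto
  also have "\<dots> = 7 / 5 * sqrt u - sqrt u * sqrt u - 2 / 5" by (simp add: field_simps)
  also have "sqrt u * sqrt u = u" using assms by (smt (verit) power2_less_0 real_sqrt_mult_self)
  finally show ?thesis by (simp add: field_simps)
qed

text \<open>
  The numbers \<open>g, p, q, s, h\<close> are the normalized weights of the pentagon edges \<open>12, 23, 34, 45, 51\<close>, and
  the assumption \<open>form\<close> is the Rayleigh inequality for the vector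
  \<open>sqrt e1, sqrt e2, sqrt (2 * e3), sqrt (2 * e4), sqrt e5\<close> after the normalization of the sum of the \<open>e i\<close> to \<open>4\<close>.
  All weights are removed from it by means of the products: \<open>p * s\<close> gives the geometric mean \<open>sqrt u\<close>, and
  \<open>g * q\<close>, \<open>h * q\<close> balance the edges at the first vertex against the opposite edge. What remains is a
  polynomial inequality in the \<open>e i\<close>.
\<close>

lemma pentagon_cycle_bound:
  fixes e1 e2 e3 e4 e5 g p q s h \<mu> \<delta> :: real
  assumes pos: "0 < e1" "0 < e2" "0 < e3" "0 < e4" "0 < e5"
    and sum: "e1 + e2 + e3 + e4 + e5 = 4"
    and up: "e1 \<le> 1 - \<delta>" "e2 \<le> 1 - \<delta>" "e3 \<le> 1 - \<delta>" "e4 \<le> 1 - \<delta>" "e5 \<le> 1 - \<delta>" and \<delta>: "0 \<le> \<delta>"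
    and least: "e1 \<le> e2" "e1 \<le> e3" "e1 \<le> e4" "e1 \<le> e5"
    and weight: "1 \<le> g" "1 \<le> p" "1 \<le> q" "1 \<le> s" "1 \<le> h"
    and prods: "2 \<le> p * s" "2 \<le> g * q" "2 \<le> h * q"
    and form: "2 * sqrt 2 * (e2 * e3 * p + e4 * e5 * s) + 4 * (e3 * e4 * q) + 2 * (e1 * (e2 * g + e5 * h))
       \<le> e1 * (\<mu> + e1) + e2 * (\<mu> + e2) + e5 * (\<mu> + e5) + 2 * (e3 * (\<mu> + e3)) + 2 * (e4 * (\<mu> + e4))"
  shows "1 + \<delta>\<^sup>2 / 4 \<le> \<mu>"
proof (rule ccontr)
  assume "\<not> ?thesis"
  hence \<mu>: "\<mu> < 1 + \<delta>\<^sup>2 / 4" by simp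
  have le1: "e1 \<le> 1" "e2 \<le> 1" "e3 \<le> 1" "e4 \<le> 1" "e5 \<le> 1" using up \<delta> by auto
  define u where "u = e2 * e3 * (e4 * e5)"
  have u_le: "u \<le> 1" unfolding u_def using pos le1 by (intro mult_le_one) auto
  have pq: "a + b - 1 \<le> a * b" if "a \<le> 1" "b \<le> 1" for a b :: real
    using mult_nonneg_nonneg[of "1 - a" "1 - b"] that by (simp add: algebra_simps)
  \<comment> \<open>a lower bound for \<open>u\<close> that is only quadratic in the deficits \<open>1 - e\<close>\<close>
  have "(e2 + e3 - 1) * (e4 + e5 - 1) \<le> u"
    unfolding u_def using pos le1 sum by (intro mult_mono pq) auto
  moreover have "(e2 + e3 - 1) * (e4 + e5 - 1)
      = (1 - e1) + ((1 - e2) + (1 - e3)) * ((1 - e4) + (1 - e5))"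
  proof -
    have e1: "e1 = 4 - e2 - e3 - e4 - e5" using sum by simp
    show ?thesis unfolding e1 by (simp add: algebra_simps)
  qed
  ultimately have u_ge: "(1 - e1) + ((1 - e2) + (1 - e3)) * ((1 - e4) + (1 - e5)) \<le> u" by simp
  have "0 \<le> ((1 - e2) + (1 - e3)) * ((1 - e4) + (1 - e5))" using le1 by auto
  hence "1 / 5 \<le> u" using u_ge sum least by linarith
  hence sq: "(5 * u + 2) / 7 \<le> sqrt u" by (intro sqrt_chord u_le) (simp add: power2_eq_square)
  have "2 * sqrt (2 * u) \<le> e2 * e3 * p + e4 * e5 * s"
    unfolding u_def using pos weight prods by (intro weighted_am_gm) auto
  hence "2 * sqrt 2 * (2 * sqrt (2 * u)) \<le> 2 * sqrt 2 * (e2 * e3 * p + e4 * e5 * s)"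
    by (intro mult_left_mono) auto
  moreover have "2 * sqrt 2 * (2 * sqrt (2 * u)) = 4 * (sqrt 2 * sqrt 2) * sqrt u"
    by (simp only: real_sqrt_mult mult_ac)
  ultimately have outer: "8 * sqrt u \<le> 2 * sqrt 2 * (e2 * e3 * p + e4 * e5 * s)"
    by simp
  \<comment> \<open>The weights \<open>g\<close> and \<open>h\<close> may drop as \<open>q\<close> grows; the slope \<open>2 / 3\<close> is what the growing
    term \<open>4 * (e3 * e4 * q)\<close> can pay for.\<close>
  have chord: "13 / 8 - 2 / 3 * (q - 1) \<le> x" if x: "1 \<le> x" "2 \<le> x * q" for x
  proof -
    have "(55 / 24)\<^sup>2 \<le> (4::real) * (2 / 3 * 2)" by (simp add: power2_eq_square)
    also have "\<dots> \<le> 4 * (2 / 3 * (x * q))" using x(2) by linarith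
    also have "\<dots> \<le> (x + 2 / 3 * q)\<^sup>2"
      using zero_le_power2[of "x - 2 / 3 * q"] by (simp add: power2_eq_square algebra_simps)
    finally have "55 / 24 \<le> x + 2 / 3 * q" by (rule power2_le_imp_le) (use x weight in auto)
    thus ?thesis by (simp add: field_simps)
  qed
  have gh: "e1 * (e2 * (13 / 8 - 2 / 3 * (q - 1)) + e5 * (13 / 8 - 2 / 3 * (q - 1))) \<le> e1 * (e2 * g + e5 * h)"
    using pos weight prods by (intro mult_left_mono add_mono chord) auto
  have "2 / 3 * (e1 * (e2 + e5)) \<le> 2 * (e3 * e4)"
  proof -
    have m: "2 / 3 * e1 \<le> x * y" if "e1 \<le> x" "2 / 3 \<le> y" for x y
      using mult_mono[of "2/3" y e1 x] that pos by (simp add: mult.commute)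
    \<comment> \<open>the deficits sum to 1 and that of \<open>e1\<close> is the largest, so one of the other two is at most \<open>1 / 3\<close>\<close>
    have "2 / 3 \<le> e3 \<or> 2 / 3 \<le> e4" using least sum le1 by linarith
    hence "2 / 3 * e1 \<le> e3 * e4" using m[of e3 e4] m[of e4 e3] least by (auto simp: mult.commute)
    moreover have "e1 * (e2 + e5) \<le> e1 * 2" using pos le1 by (intro mult_left_mono) auto
    ultimately show ?thesis by simp
  qed
  hence "2 * (2 / 3 * (e1 * (e2 + e5))) * (q - 1) \<le> 2 * (2 * (e3 * e4)) * (q - 1)"
    using weight by (intro mult_right_mono) auto
  moreover have "2 * (2 * (e3 * e4)) * (q - 1) = 4 * (e3 * e4 * q) - 4 * (e3 * e4)"
    by (simp add: algebra_simps)
  moreover have "e1 * (e2 * (13 / 8 - 2 / 3 * (q - 1)) + e5 * (13 / 8 - 2 / 3 * (q - 1)))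
      = 13 / 8 * (e1 * (e2 + e5)) - 2 / 3 * (e1 * (e2 + e5)) * (q - 1)"
    by (simp add: field_simps)
  ultimately have inner: "4 * (e3 * e4) + 13 / 4 * (e1 * (e2 + e5))
      \<le> 4 * (e3 * e4 * q) + 2 * (e1 * (e2 * g + e5 * h))"
    using gh by linarith
  define Z where "Z = e1 + e2 + e5 + 2 * e3 + 2 * e4"
  have Z: "0 < Z" "Z \<le> 6" unfolding Z_def using pos sum le1 by auto
  have "(\<mu> - 1) * Z < \<delta>\<^sup>2 / 4 * Z" using \<mu> Z by (intro mult_strict_right_mono) auto
  also have "\<dots> \<le> \<delta>\<^sup>2 / 4 * 6" using Z by (intro mult_left_mono) auto
  finally have "(\<mu> - 1) * Z < 3 / 2 * \<delta>\<^sup>2" by simp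
  moreover have "e1 * (\<mu> + e1) + e2 * (\<mu> + e2) + e5 * (\<mu> + e5) + 2 * (e3 * (\<mu> + e3)) + 2 * (e4 * (\<mu> + e4))
      = e1 * (1 + e1) + e2 * (1 + e2) + e5 * (1 + e5) + 2 * (e3 * (1 + e3)) + 2 * (e4 * (1 + e4)) + (\<mu> - 1) * Z"
    unfolding Z_def by (simp add: algebra_simps)
  ultimately have "8 * ((5 * u + 2) / 7) + 4 * (e3 * e4) + 13 / 4 * (e1 * (e2 + e5))
      < e1 * (1 + e1) + e2 * (1 + e2) + e5 * (1 + e5) + 2 * (e3 * (1 + e3)) + 2 * (e4 * (1 + e4)) + 3 / 2 * \<delta>\<^sup>2"
    using form outer inner sq by linarith
  moreover have "e1 * (1 + e1) + e2 * (1 + e2) + e5 * (1 + e5) + 2 * (e3 * (1 + e3)) + 2 * (e4 * (1 + e4))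
      + 7 / 4 * \<delta>\<^sup>2 \<le> (40 * ((1 - e1) + ((1 - e2) + (1 - e3)) * ((1 - e4) + (1 - e5))) + 16) / 7
      + 4 * (e3 * e4) + 13 / 4 * (e1 * (e2 + e5))"
    using pentagon_quadratic_inequality[of "1 - e1" "1 - e2" "1 - e3" "1 - e4" "1 - e5" \<delta>] sum up \<delta> least
    by simp
  moreover have "(40 * ((1 - e1) + ((1 - e2) + (1 - e3)) * ((1 - e4) + (1 - e5))) + 16) / 7
      \<le> 8 * ((5 * u + 2) / 7)"
    using u_ge by simp
  moreover have "0 \<le> \<delta>\<^sup>2" by simp
  ultimately show False by linarith
qed

section \<open>The gap above the third eigenvalue\<close>

lemma split_pentagon_rotate: "split_pentagon F a b c d e \<Longrightarrow> split_pentagon F b c d e a"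
  unfolding split_pentagon_def by blast

text \<open>
  A pentagon may be rotated; the test vector below singles out the vertex with the largest diagonal entry.
\<close>

lemma ex_split_pentagon_from_max:
  fixes f :: "'a \<Rightarrow> real"
  assumes I: "I = {a, b, c, d, e}" and dist: "distinct [a, b, c, d, e]" and p: "split_pentagon F a b c d e"
  shows "\<exists>a b c d e. I = {a, b, c, d, e} \<and> distinct [a, b, c, d, e] \<and> split_pentagon F a b c d e \<and> (\<forall>i\<in>I. f i \<le> f a)"
proof -
  have "finite (f ` I)" "f ` I \<noteq> {}" using I by auto
  from Max_in[OF this] obtain m where m: "m \<in> I" "f m = Max (f ` I)" by auto
  hence max: "\<forall>i\<in>I. f i \<le> f m" using \<open>finite (f ` I)\<close> by auto
  define P where "P = (\<lambda>a b c d e. I = {a, b, c, d, e} \<and> distinct [a, b, c, d, e] \<and> split_pentagon F a b c d e)"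
  have rot: "P b c d e a" if "P a b c d e" for a b c d e
    using that split_pentagon_rotate[of F a b c d e] unfolding P_def by (auto simp: insert_commute)
  have 1: "P a b c d e" using assms unfolding P_def by blast
  note 2 = rot[OF 1] note 3 = rot[OF 2] note 4 = rot[OF 3] note 5 = rot[OF 4]
  have "\<exists>b c d e. P m b c d e" using m(1) 1 2 3 4 5 unfolding I by blast
  thus ?thesis using max unfolding P_def by blast
qed

lemma pentagon_cycle_bound_scaled:
  fixes e1 e2 e3 e4 e5 g p q s h \<nu> \<delta> N :: real
  assumes N: "0 < N" and pos: "0 < e1" "0 < e2" "0 < e3" "0 < e4" "0 < e5"
    and sum: "e1 + e2 + e3 + e4 + e5 = 4 * N"
    and up: "e1 \<le> N * (1 - \<delta>)" "e2 \<le> N * (1 - \<delta>)" "e3 \<le> N * (1 - \<delta>)" "e4 \<le> N * (1 - \<delta>)" "e5 \<le> N * (1 - \<delta>)"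
    and \<delta>: "0 \<le> \<delta>"
    and least: "e1 \<le> e2" "e1 \<le> e3" "e1 \<le> e4" "e1 \<le> e5"
    and weight: "1 \<le> g" "1 \<le> p" "1 \<le> q" "1 \<le> s" "1 \<le> h"
    and prods: "2 \<le> p * s" "2 \<le> g * q" "2 \<le> h * q"
    and form: "2 * sqrt 2 * (e2 * e3 * p + e4 * e5 * s) + 4 * (e3 * e4 * q) + 2 * (e1 * (e2 * g + e5 * h))
       \<le> e1 * (\<nu> + e1) + e2 * (\<nu> + e2) + e5 * (\<nu> + e5) + 2 * (e3 * (\<nu> + e3)) + 2 * (e4 * (\<nu> + e4))"
  shows "N * (1 + \<delta>\<^sup>2 / 4) \<le> \<nu>"
proof -
  have "1 + \<delta>\<^sup>2 / 4 \<le> \<nu> / N"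
  proof (rule pentagon_cycle_bound[of "e1 / N" "e2 / N" "e3 / N" "e4 / N" "e5 / N" \<delta> g p q s h "\<nu> / N"])
    show "e1 / N + e2 / N + e3 / N + e4 / N + e5 / N = 4"
      using sum N by (simp add: field_simps)
    have scale: "x * (y * z) / (N * N) = x * (y / N) * (z / N)" for x y z by simp
    have "(2 * sqrt 2 * (e2 * e3 * p + e4 * e5 * s) + 4 * (e3 * e4 * q) + 2 * (e1 * (e2 * g + e5 * h))) / (N * N)
       \<le> (e1 * (\<nu> + e1) + e2 * (\<nu> + e2) + e5 * (\<nu> + e5) + 2 * (e3 * (\<nu> + e3)) + 2 * (e4 * (\<nu> + e4))) / (N * N)"
      using form N by (intro divide_right_mono) auto
    thus "2 * sqrt 2 * (e2 / N * (e3 / N) * p + e4 / N * (e5 / N) * s) + 4 * (e3 / N * (e4 / N) * q)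
        + 2 * (e1 / N * (e2 / N * g + e5 / N * h))
      \<le> e1 / N * (\<nu> / N + e1 / N) + e2 / N * (\<nu> / N + e2 / N) + e5 / N * (\<nu> / N + e5 / N)
        + 2 * (e3 / N * (\<nu> / N + e3 / N)) + 2 * (e4 / N * (\<nu> / N + e4 / N))"
      by (simp add: add_divide_distrib distrib_left distrib_right)
  qed (use assms in \<open>simp_all add: field_simps\<close>)
  thus ?thesis using N by (simp add: field_simps)
qed

text \<open>
  With \<open>N = (5 * t - S) / 4\<close> the numbers \<open>t - A i i\<close> sum to \<open>4 * N\<close>, and each of them is at most
  \<open>t = N * (1 - \<delta>)\<close> for \<open>\<delta> = (t - S) / (5 * t - S)\<close>. This \<open>\<delta>\<close> is the surplus of the estimate.
\<close>

lemma positive_on_span_gap: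
  fixes A :: "'a \<Rightarrow> 'a \<Rightarrow> real"
  assumes I: "I = {v, w, x, y, z}" and dist: "distinct [v, w, x, y, z]"
    and sym: "\<And>i j. i \<in> I \<Longrightarrow> j \<in> I \<Longrightarrow> A i j = A j i"
    and nn: "\<And>i j. i \<in> I \<Longrightarrow> j \<in> I \<Longrightarrow> 0 \<le> A i j"
    and tr: "(\<Sum>i\<in>I. A i i) < t"
    and P: "positive_on_span I (\<lambda>i j. A i j - (if i = j then t else 0)) v1 v2 v3"
    and top: "\<And>u. form I A u u \<le> L * (\<Sum>i\<in>I. (u i)\<^sup>2)"
  defines "S \<equiv> \<Sum>i\<in>I. A i i"
  shows "(5 * t - S) / 4 * (1 + ((t - S) / (5 * t - S))\<^sup>2 / 4) \<le> L - t"
proof -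
  define F where "F = (\<lambda>i j. A i j - (if i = j then t else 0))"
  have fin: "finite I" using I by simp
  have le_S: "A i i \<le> S" if "i \<in> I" for i
    unfolding S_def using that nn fin by (intro member_le_sum[of i I "\<lambda>i. A i i"]) auto
  have M: "sym_metzler I F"
    unfolding sym_metzler_def F_def using le_S tr sym nn unfolding S_def[symmetric] by fastforce
  obtain a b c d e where I2: "I = {a, b, c, d, e}" and d2: "distinct [a, b, c, d, e]"
    and pent: "split_pentagon F a b c d e" and max: "\<forall>i\<in>I. A i i \<le> A a a"
    using ex_split_pentagon[OF M I dist P[folded F_def]] ex_split_pentagon_from_max[where f = "\<lambda>i. A i i"]
    by (elim exE conjE) metis
  have mem: "a \<in> I" "b \<in> I" "c \<in> I" "d \<in> I" "e \<in> I" using I2 by auto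
  define E where "E = (\<lambda>i. t - A i i)"
  define r where "r = (\<lambda>i. sqrt (E i))"
  have E: "0 < E i" if "i \<in> I" for i using le_S[OF that] tr unfolding E_def S_def by linarith
  have r: "0 < r i" "(r i)\<^sup>2 = E i" "F i i = - (r i)\<^sup>2" if "i \<in> I" for i
    using E[OF that] by (auto simp: r_def F_def E_def)
  have S: "S = A a a + A b b + A c c + A d d + A e e" unfolding S_def I2 using d2 by simp
  have S0: "0 \<le> S" "S < t" using nn mem tr unfolding S_def by (auto intro: sum_nonneg)
  have edge: "r i * r j \<le> F i j" if "splits F i j k l" "{i, j, k, l} \<subseteq> I" "distinct [i, j, k, l]" for i j k l
  proof (rule power2_le_imp_le)
    have "i \<in> I" "j \<in> I" using that by auto
    with splits_edge(2)[OF M that(2,3,1)] show "(r i * r j)\<^sup>2 \<le> (F i j)\<^sup>2"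
      using r(3) by (simp add: power_mult_distrib)
    show "0 \<le> F i j" using splits_edge(1)[OF M that(2,3,1)] by simp
  qed
  have sub: "{a, b, c, d} \<subseteq> I" "{b, c, d, e} \<subseteq> I" "{c, d, e, a} \<subseteq> I" "{d, e, a, b} \<subseteq> I" "{e, a, b, c} \<subseteq> I"
    using mem by auto
  have dd: "distinct [a, b, c, d]" "distinct [b, c, d, e]" "distinct [c, d, e, a]" "distinct [d, e, a, b]" "distinct [e, a, b, c]"
    using d2 by auto
  have sp: "splits F a b c d" "splits F b c d e" "splits F c d e a" "splits F d e a b" "splits F e a b c"
    using pent unfolding split_pentagon_def by auto
  note edges = edge[OF sp(1) sub(1) dd(1)] edge[OF sp(2) sub(2) dd(2)] edge[OF sp(3) sub(3) dd(3)]
    edge[OF sp(4) sub(4) dd(4)] edge[OF sp(5) sub(5) dd(5)]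
  have prod: "2 * (r i * r j * r k * r l) \<le> F i j * F k l"
    if "splits F i j k l" "{i, j, k, l} \<subseteq> I" "distinct [i, j, k, l]" "r j * r k \<le> F j k" for i j k l
    using that r by (intro splits_product_bound[OF M that(2,3,1)]) auto
  note prods = prod[OF sp(1) sub(1) dd(1) edges(2)] prod[OF sp(2) sub(2) dd(2) edges(3)] prod[OF sp(3) sub(3) dd(3) edges(4)]
  define \<phi> where "\<phi> = (\<lambda>i j. F i j / (r i * r j))"
  have F: "F i j = \<phi> i j * (r i * r j)" if "i \<in> I" "j \<in> I" for i j
    using r(1)[OF that(1)] r(1)[OF that(2)] unfolding \<phi>_def by simp
  have one: "1 \<le> \<phi> i j" if "r i * r j \<le> F i j" "i \<in> I" "j \<in> I" for i j
    using that r(1)[OF that(2)] r(1)[OF that(3)] unfolding \<phi>_def by simp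
  have two: "2 \<le> \<phi> i j * \<phi> k l" if "2 * (r i * r j * r k * r l) \<le> F i j * F k l" "i \<in> I" "j \<in> I" "k \<in> I" "l \<in> I" for i j k l
  proof -
    have "0 < r i * r j * (r k * r l)" using r(1) that by simp
    thus ?thesis using that(1) unfolding \<phi>_def by (simp add: pos_le_divide_eq mult.assoc)
  qed
  \<comment> \<open>The factor \<open>sqrt 2\<close> sits on the edge opposite to the vertex of largest diagonal entry. If that entry
    is the only nonzero one and equals \<open>t\<close>, then \<open>r a = 0\<close> and this is the Perron vector of the path
    \<open>b c d e\<close> with the extremal weights \<open>sqrt 2, 1, sqrt 2\<close> (times \<open>t\<close>).\<close>
  define u where "u = (\<lambda>i. (if i = c \<or> i = d then sqrt 2 else 1) * r i)"
  have u: "u a = r a" "u b = r b" "u c = sqrt 2 * r c" "u d = sqrt 2 * r d" "u e = r e"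
    using d2 unfolding u_def by auto
  have ne: "a \<noteq> b" "a \<noteq> c" "a \<noteq> d" "a \<noteq> e" "b \<noteq> c" "b \<noteq> d" "b \<noteq> e" "c \<noteq> d" "c \<noteq> e" "d \<noteq> e"
    using d2 by auto
  have flip: "A b a = A a b" "A c a = A a c" "A d a = A a d" "A a e = A e a" "A c b = A b c" "A d b = A b d" "A e b = A b e"
    "A d c = A c d" "A e c = A c e" "A e d = A d e"
    using sym mem by auto
  have FA: "F a b = A a b" "F b c = A b c" "F c d = A c d" "F d e = A d e" "F e a = A e a"
    using ne unfolding F_def by auto
  have sq2: "sqrt 2 * sqrt 2 = (2::real)" by simp
  have nu: "0 \<le> u i" if "i \<in> I" for i using r(1)[OF that] unfolding u_def by auto
  have "0 \<le> 2 * (A a c * u a * u c + A a d * u a * u d + A b d * u b * u d + A b e * u b * u e + A c e * u c * u e)"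
    using nn mem nu by simp
  hence "A a a * (u a)\<^sup>2 + A b b * (u b)\<^sup>2 + A c c * (u c)\<^sup>2 + A d d * (u d)\<^sup>2 + A e e * (u e)\<^sup>2
      + 2 * (A a b * u a * u b + A b c * u b * u c + A c d * u c * u d + A d e * u d * u e + A e a * u e * u a)
    \<le> A a a * (u a)\<^sup>2 + A b b * (u b)\<^sup>2 + A c c * (u c)\<^sup>2 + A d d * (u d)\<^sup>2 + A e e * (u e)\<^sup>2
      + 2 * (A a b * u a * u b + A b c * u b * u c + A c d * u c * u d + A d e * u d * u e + A e a * u e * u a)
      + 2 * (A a c * u a * u c + A a d * u a * u d + A b d * u b * u d + A b e * u b * u e + A c e * u c * u e)"
    by (rule le_add_same_cancel1[THEN iffD2])
  also have "\<dots> = form I A u u"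
    unfolding form_def I2 using ne by (simp add: flip power2_eq_square algebra_simps)
  also have "\<dots> \<le> L * (\<Sum>i\<in>I. (u i)\<^sup>2)" by (rule top)
  also have "(\<Sum>i\<in>I. (u i)\<^sup>2) = (u a)\<^sup>2 + (u b)\<^sup>2 + (u c)\<^sup>2 + (u d)\<^sup>2 + (u e)\<^sup>2"
    unfolding I2 using ne by simp
  finally have main: "A a a * (u a)\<^sup>2 + A b b * (u b)\<^sup>2 + A c c * (u c)\<^sup>2 + A d d * (u d)\<^sup>2 + A e e * (u e)\<^sup>2
      + 2 * (A a b * u a * u b + A b c * u b * u c + A c d * u c * u d + A d e * u d * u e + A e a * u e * u a)
    \<le> L * ((u a)\<^sup>2 + (u b)\<^sup>2 + (u c)\<^sup>2 + (u d)\<^sup>2 + (u e)\<^sup>2)" .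
  have usq: "(u a)\<^sup>2 = E a" "(u b)\<^sup>2 = E b" "(u c)\<^sup>2 = 2 * E c" "(u d)\<^sup>2 = 2 * E d" "(u e)\<^sup>2 = E e"
    unfolding u using r(2) mem by (simp_all add: power_mult_distrib)
  have ed: "A a b * u a * u b = E a * E b * \<phi> a b" "A b c * u b * u c = sqrt 2 * (E b * E c * \<phi> b c)"
    "A c d * u c * u d = 2 * (E c * E d * \<phi> c d)" "A d e * u d * u e = sqrt 2 * (E d * E e * \<phi> d e)"
    "A e a * u e * u a = E a * E e * \<phi> e a"
  proof -
    have rr: "\<phi> i j * (r i * r j) * (r i * r j) = E i * E j * \<phi> i j" if "i \<in> I" "j \<in> I" for i j
      unfolding r(2)[OF that(1), symmetric] r(2)[OF that(2), symmetric] by (simp add: power2_eq_square)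
    show "A a b * u a * u b = E a * E b * \<phi> a b"
      using rr[of a b] mem unfolding FA[symmetric] F[OF mem(1,2)] u by (simp add: mult_ac)
    show "A b c * u b * u c = sqrt 2 * (E b * E c * \<phi> b c)"
      using rr[of b c] mem unfolding FA[symmetric] F[OF mem(2,3)] u by (simp add: mult_ac)
    have "A c d * u c * u d = (sqrt 2 * sqrt 2) * (\<phi> c d * (r c * r d) * (r c * r d))"
      unfolding FA[symmetric] F[OF mem(3,4)] u by (simp only: mult_ac)
    thus "A c d * u c * u d = 2 * (E c * E d * \<phi> c d)" unfolding sq2 rr[OF mem(3,4)] .
    show "A d e * u d * u e = sqrt 2 * (E d * E e * \<phi> d e)"
      using rr[of d e] mem unfolding FA[symmetric] F[OF mem(4,5)] u by (simp add: mult_ac)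
    show "A e a * u e * u a = E a * E e * \<phi> e a"
      using rr[of e a] mem unfolding FA[symmetric] F[OF mem(5,1)] u by (simp add: mult_ac)
  qed
  have A: "A i i = t - E i" for i unfolding E_def by simp
  show ?thesis
  proof (rule pentagon_cycle_bound_scaled[of _ "E a" "E b" "E c" "E d" "E e" _ "\<phi> a b" "\<phi> b c" "\<phi> c d" "\<phi> d e" "\<phi> e a"])
    show "0 < (5 * t - S) / 4" "0 \<le> (t - S) / (5 * t - S)" using S0 by auto
    have "E i \<le> (5 * t - S) / 4 * (1 - (t - S) / (5 * t - S))" if "i \<in> I" for i
    proof -
      have "(5 * t - S) / 4 * (1 - (t - S) / (5 * t - S)) = t" using S0 by (simp add: field_simps)
      thus ?thesis using nn[OF that that] unfolding E_def by simp
    qed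
    thus "E a \<le> (5 * t - S) / 4 * (1 - (t - S) / (5 * t - S))" "E b \<le> (5 * t - S) / 4 * (1 - (t - S) / (5 * t - S))"
      "E c \<le> (5 * t - S) / 4 * (1 - (t - S) / (5 * t - S))" "E d \<le> (5 * t - S) / 4 * (1 - (t - S) / (5 * t - S))"
      "E e \<le> (5 * t - S) / 4 * (1 - (t - S) / (5 * t - S))" using mem by auto
    show "E a + E b + E c + E d + E e = 4 * ((5 * t - S) / 4)" unfolding S E_def by simp
    show "E a \<le> E b" "E a \<le> E c" "E a \<le> E d" "E a \<le> E e" using max mem unfolding E_def by auto
    show "1 \<le> \<phi> a b" "1 \<le> \<phi> b c" "1 \<le> \<phi> c d" "1 \<le> \<phi> d e" "1 \<le> \<phi> e a"
      using one edges mem by auto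
    show "2 \<le> \<phi> b c * \<phi> d e" "2 \<le> \<phi> a b * \<phi> c d" using two prods mem by auto
    show "2 \<le> \<phi> e a * \<phi> c d" using two[OF prods(3)] mem by (simp add: mult.commute)
    show "2 * sqrt 2 * (E b * E c * \<phi> b c + E d * E e * \<phi> d e) + 4 * (E c * E d * \<phi> c d) + 2 * (E a * (E b * \<phi> a b + E e * \<phi> e a))
      \<le> E a * (L - t + E a) + E b * (L - t + E b) + E e * (L - t + E e) + 2 * (E c * (L - t + E c)) + 2 * (E d * (L - t + E d))"
      using main unfolding usq ed A by (simp add: algebra_simps)
  qed (use E mem in auto)
qed

section \<open>Spectral decomposition of real symmetric matrices\<close>

text \<open>
  Gram-Schmidt orthogonalization followed by normalization of the columns.
\<close>

lemma orthonormal_extension: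
  fixes v :: "real vec"
  assumes v: "v \<in> carrier_vec n" "v \<noteq> 0\<^sub>v n"
  obtains W where "W \<in> carrier_mat n n" "transpose_mat W * W = 1\<^sub>m n" "\<exists>k. col W 0 = k \<cdot>\<^sub>v v"
proof -
  interpret cof_vec_space n "TYPE(real)" .
  have n: "0 < n" using v by (cases n) auto
  define ws where "ws = gram_schmidt n (basis_completion v)"
  from basis_completion[OF v]
  have b: "distinct (basis_completion v)" "\<not> lin_dep (set (basis_completion v))"
    "set (basis_completion v) \<subseteq> carrier_vec n" "hd (basis_completion v) = v" "length (basis_completion v) = n" by auto
  from gram_schmidt_result[OF b(3,1,2) refl, folded ws_def]
  have ws: "set ws \<subseteq> carrier_vec n" "corthogonal ws" "length ws = n" using b(5) by auto
  obtain vs where "basis_completion v = v # vs" using b(4,5) n by (cases "basis_completion v") auto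
  hence hd: "hd ws = v" unfolding ws_def using gram_schmidt_hd[OF v(1)] by simp
  have wi: "ws ! i \<in> carrier_vec n" if "i < n" for i using ws that by (metis nth_mem subsetD)
  have orth: "(ws ! i \<bullet> ws ! j = 0) = (i \<noteq> j)" if "i < n" "j < n" for i j
    using corthogonalD[OF ws(2), of i j] that ws(3) by simp
  define c where "c = (\<lambda>i. 1 / sqrt (ws ! i \<bullet> ws ! i))"
  define W where "W = mat_of_cols n (map (\<lambda>i. c i \<cdot>\<^sub>v ws ! i) [0..<n])"
  have W: "W \<in> carrier_mat n n" unfolding W_def by (simp add: mat_of_cols_carrier(1)[of n "map f [0..<n]" for f, simplified])
  have col: "col W i = c i \<cdot>\<^sub>v ws ! i" if "i < n" for i
    unfolding W_def using that wi[OF that] by (subst col_mat_of_cols) auto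
  have "transpose_mat W * W = 1\<^sub>m n"
  proof (rule eq_matI)
    fix i j assume "i < dim_row (1\<^sub>m n :: real mat)" "j < dim_col (1\<^sub>m n :: real mat)"
    hence ij: "i < n" "j < n" by auto
    have "(transpose_mat W * W) $$ (i, j) = col W i \<bullet> col W j" using W ij by simp
    also have "\<dots> = c i * (c j * (ws ! i \<bullet> ws ! j))"
      unfolding col[OF ij(1)] col[OF ij(2)] using wi[OF ij(1)] wi[OF ij(2)] by simp
    also have "\<dots> = (1\<^sub>m n :: real mat) $$ (i, j)"
    proof (cases "i = j")
      case True
      have "0 \<le> ws ! j \<bullet> ws ! j" unfolding scalar_prod_def by (intro sum_nonneg) auto
      moreover have "ws ! j \<bullet> ws ! j \<noteq> 0" using orth[OF ij(2) ij(2)] by simp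
      ultimately show ?thesis using True ij unfolding c_def by simp
    next
      case False
      thus ?thesis using orth[OF ij] ij by simp
    qed
    finally show "(transpose_mat W * W) $$ (i, j) = (1\<^sub>m n :: real mat) $$ (i, j)" .
  qed (use W in auto)
  moreover have "col W 0 = c 0 \<cdot>\<^sub>v v" using col[OF n] hd ws(3) n by (metis hd_conv_nth length_greater_0_conv)
  ultimately show thesis using that W by blast
qed

text \<open>
  The order of the eigenvalues on the diagonal is prescribed. As in the Schur decomposition, an
  eigenvector is extended to an orthonormal basis and split off; by symmetry the first row of the transformed
  matrix vanishes together with its first column.
\<close>

lemma real_symmetric_diagonalization:
  fixes A :: "real mat"
  assumes "A \<in> carrier_mat n n" "transpose_mat A = A" "char_poly A = (\<Prod>e\<leftarrow>es. [:- e, 1:])"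
  shows "\<exists>P \<in> carrier_mat n n. transpose_mat P * P = 1\<^sub>m n
     \<and> transpose_mat P * A * P = mat_diag n (\<lambda>i. es ! i)"
  using assms
proof (induction es arbitrary: n A)
  case Nil
  with degree_monic_char_poly[of A n] have "n = 0" by auto
  thus ?case using Nil by (intro bexI[of _ "1\<^sub>m 0"]) (auto intro!: eq_matI simp: mat_diag_def)
next
  case (Cons e es n A)
  note A = Cons.prems(1) and sym = Cons.prems(2)
  have cp: "char_poly A = [:- e, 1:] * (\<Prod>e\<leftarrow>es. [:- e, 1:])" using Cons.prems(3) by simp
  have mon: "monic (\<Prod>e\<leftarrow>es. [:- e, 1:])" by (rule monic_prod_list) auto
  have "degree (char_poly A) = Suc (degree (\<Prod>e\<leftarrow>es. [:- e, 1:]))"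
    unfolding cp by (subst degree_mult_eq) (use mon in auto)
  then obtain m where n: "n = Suc m" using degree_monic_char_poly[OF A] by auto
  have "eigenvalue A e" unfolding eigenvalue_root_char_poly[OF A] cp by simp
  then obtain v where v: "v \<in> carrier_vec n" "v \<noteq> 0\<^sub>v n" "A *\<^sub>v v = e \<cdot>\<^sub>v v"
    unfolding eigenvalue_def eigenvector_def using A by auto
  obtain W k where W: "W \<in> carrier_mat n n" and WW: "transpose_mat W * W = 1\<^sub>m n" and col0: "col W 0 = k \<cdot>\<^sub>v v"
    using orthonormal_extension[OF v(1,2)] by metis
  have WT: "transpose_mat W \<in> carrier_mat n n" using W by simp
  have WW': "W * transpose_mat W = 1\<^sub>m n" by (rule mat_mult_left_right_inverse[OF WT W WW])
  define B where "B = transpose_mat W * A * W"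
  have B: "B \<in> carrier_mat n n" unfolding B_def using W A by auto
  have symB: "transpose_mat B = B"
    unfolding B_def using W A WT sym by (simp add: transpose_mult[of _ n n _ n] assoc_mult_mat[of _ n n _ n _ n])
  have eig: "A *\<^sub>v col W 0 = e \<cdot>\<^sub>v col W 0"
    unfolding col0 using v A by (simp add: mult_mat_vec smult_smult_assoc mult.commute)
  have B0: "B $$ (i, 0) = (if i = 0 then e else 0)" if i: "i < n" for i
  proof -
    have "B $$ (i, 0) = col W i \<bullet> col (A * W) 0"
      unfolding B_def using W A i n by (simp add: assoc_mult_mat[of _ n n _ n _ n])
    also have "col (A * W) 0 = A *\<^sub>v col W 0" using A W n by (intro col_mult2) auto
    also have "col W i \<bullet> (A *\<^sub>v col W 0) = e * (col W i \<bullet> col W 0)"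
      unfolding eig using W i n by (simp add: col_carrier_vec[of _ n])
    also have "col W i \<bullet> col W 0 = (transpose_mat W * W) $$ (i, 0)" using W i n by simp
    finally show ?thesis unfolding WW using i n by simp
  qed
  have B0': "B $$ (0, i) = (if i = 0 then e else 0)" if i: "i < n" for i
    using B0[OF i] B i n arg_cong[OF symB, of "\<lambda>M. M $$ (i, 0)"] by simp
  define C where "C = mat m m (\<lambda>(i, j). B $$ (Suc i, Suc j))"
  have C: "C \<in> carrier_mat m m" unfolding C_def by simp
  have symC: "transpose_mat C = C"
  proof (rule eq_matI)
    fix i j assume "i < dim_row C" "j < dim_col C"
    thus "transpose_mat C $$ (i, j) = C $$ (i, j)"
      using B n arg_cong[OF symB, of "\<lambda>M. M $$ (Suc i, Suc j)"] unfolding C_def by simp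
  qed (auto simp: C_def)
  define E where "E = mat 1 1 (\<lambda>_. e)"
  have E: "E \<in> carrier_mat 1 1" unfolding E_def by simp
  have Bblock: "B = four_block_mat E (0\<^sub>m 1 m) (0\<^sub>m m 1) C"
    by (rule eq_matI) (use B n B0 B0' in \<open>auto simp: E_def C_def gr0_conv_Suc less_Suc_eq_0_disj\<close>)
  have "similar_mat A B"
  proof -
    have "A = W * B * transpose_mat W"
    proof -
      have "W * B * transpose_mat W = (W * transpose_mat W) * A * (W * transpose_mat W)"
        unfolding B_def using W A WT by (simp add: assoc_mult_mat[of _ n n _ n _ n])
      thus ?thesis unfolding WW' using A by simp
    qed
    hence "similar_mat_wit A B W (transpose_mat W)"
      using W A B WT WW WW' by (intro similar_mat_witI) auto
    thus ?thesis unfolding similar_mat_def by blast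
  qed
  from char_poly_similar[OF this] have "char_poly A = char_poly E * char_poly C"
    unfolding Bblock char_poly_four_block_zeros_col[OF E zero_carrier_mat C] .
  moreover have "char_poly E = [:- e, 1:]" unfolding E_def by (simp add: char_poly_defs det_def sign_def)
  ultimately have "char_poly C = (\<Prod>e\<leftarrow>es. [:- e, 1:])"
    using cp by (metis mult_cancel_left pCons_eq_0_iff zero_neq_one)
  from Cons.IH[OF C symC this] obtain Q where Q: "Q \<in> carrier_mat m m" "transpose_mat Q * Q = 1\<^sub>m m"
    and diag: "transpose_mat Q * C * Q = mat_diag m (\<lambda>i. es ! i)" by blast
  define R where "R = four_block_mat (1\<^sub>m 1) (0\<^sub>m 1 m) (0\<^sub>m m 1) Q"
  have R: "R \<in> carrier_mat n n" unfolding R_def n using Q by auto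
  have RT: "transpose_mat R = four_block_mat (1\<^sub>m 1) (0\<^sub>m 1 m) (0\<^sub>m m 1) (transpose_mat Q)"
    unfolding R_def using Q by (subst transpose_four_block_mat) auto
  have RR: "transpose_mat R * R = 1\<^sub>m n"
    unfolding RT unfolding R_def n using Q four_block_one_mat[of 1 m]
    by (subst mult_four_block_mat[of _ 1 1 _ m _ m _ _ 1 _ m]) auto
  have RBR: "transpose_mat R * B * R = mat_diag n (\<lambda>i. (e # es) ! i)"
  proof -
    have "transpose_mat R * B = four_block_mat E (0\<^sub>m 1 m) (0\<^sub>m m 1) (transpose_mat Q * C)"
      unfolding RT Bblock using Q C E by (subst mult_four_block_mat[of _ 1 1 _ m _ m _ _ 1 _ m]) auto
    hence "transpose_mat R * B * R = four_block_mat E (0\<^sub>m 1 m) (0\<^sub>m m 1) (mat_diag m (\<lambda>i. es ! i))"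
      unfolding R_def diag[symmetric] using Q C E
      by (simp add: mult_four_block_mat[of _ 1 1 _ m _ m _ _ 1 _ m])
    also have "\<dots> = mat_diag n (\<lambda>i. (e # es) ! i)"
      by (rule eq_matI) (auto simp: n E_def mat_diag_def less_Suc_eq_0_disj split: if_splits)
    finally show ?thesis .
  qed
  show ?case
  proof (intro bexI conjI)
    show "W * R \<in> carrier_mat n n" using W R by simp
    have T: "transpose_mat (W * R) = transpose_mat R * transpose_mat W" using W R by (rule transpose_mult)
    have RTc: "transpose_mat R \<in> carrier_mat n n" using R by simp
    have "transpose_mat (W * R) * (W * R) = transpose_mat R * (transpose_mat W * W) * R"
      unfolding T using W R WT RTc by (simp add: assoc_mult_mat[of _ n n _ n _ n])
    thus "transpose_mat (W * R) * (W * R) = 1\<^sub>m n" unfolding WW using RTc RR by simp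
    have "transpose_mat (W * R) * A * (W * R) = transpose_mat R * B * R"
      unfolding T B_def using W R WT RTc A by (simp add: assoc_mult_mat[of _ n n _ n _ n])
    thus "transpose_mat (W * R) * A * (W * R) = mat_diag n (\<lambda>i. (e # es) ! i)" unfolding RBR .
  qed
qed

text \<open>
  The multiset of complex roots determines a monic complex polynomial, and a real polynomial is determined by
  its complex image.
\<close>

lemma char_poly_of_is_spectrum:
  assumes A: "A \<in> carrier_mat n n" and s: "is_spectrum_of ls A"
  shows "char_poly A = (\<Prod>e\<leftarrow>ls. [:- e, 1:])"
proof -
  interpret poly: map_poly_inj_idom_hom complex_of_real ..
  let ?A = "map_mat complex_of_real A"
  have "?A \<in> carrier_mat n n" using A by simp
  from char_poly_factorized[OF this] obtain as where as: "char_poly ?A = (\<Prod>a\<leftarrow>as. [:- a, 1:])" by blast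
  have "proots (char_poly ?A) = mset as"
    unfolding as
  proof (induction as)
    case (Cons a as)
    have "(\<Prod>a\<leftarrow>as. [:- a, 1:]) \<noteq> 0" by (auto simp: prod_list_zero_iff)
    thus ?case using Cons by (simp add: proots_mult del: mult_pCons_left)
  qed simp
  hence m: "mset as = mset (map complex_of_real ls)" using s unfolding is_spectrum_of_def real_mat_spectrum_def by simp
  have mset: "(\<Prod>a\<leftarrow>xs. [:- a, 1:]) = prod_mset (image_mset (\<lambda>a. [:- a, 1:]) (mset xs))" for xs :: "complex list"
    by (simp only: prod_mset_prod_list[symmetric] mset_map)
  have "char_poly ?A = (\<Prod>a\<leftarrow>map complex_of_real ls. [:- a, 1:])"
    unfolding as mset m ..
  also have "\<dots> = map_poly complex_of_real (\<Prod>e\<leftarrow>ls. [:- e, 1:])"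
  proof (induction ls)
    case (Cons e ls)
    have "map_poly complex_of_real [:- e, 1:] = [:- complex_of_real e, 1:]" by simp
    with Cons show ?case
      by (simp only: list.map prod_list.Cons poly.hom_mult)
  qed simp
  finally have "map_poly complex_of_real (char_poly A) = map_poly complex_of_real (\<Prod>e\<leftarrow>ls. [:- e, 1:])"
    by (simp only: of_real_hom.char_poly_hom[OF A])
  thus ?thesis by (rule poly.injectivity)
qed

section \<open>Spectra of nonnegative symmetric matrices of order five\<close>

text \<open>
  The rows \<open>q k\<close> are orthonormal eigenvectors: in the coordinates they define, the quadratic form of \<open>A\<close> is
  diagonal and the Euclidean norm is preserved.
\<close>

lemma spectral_coordinates:
  fixes A :: "real mat"
  assumes A: "A \<in> carrier_mat n n" and sym: "transpose_mat A = A" and spec: "is_spectrum_of ls A" and len: "length ls = n"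
  obtains q :: "nat \<Rightarrow> nat \<Rightarrow> real" where
    "\<And>k l. k < n \<Longrightarrow> l < n \<Longrightarrow> (\<Sum>i<n. q k i * q l i) = (if k = l then 1 else 0)"
    "\<And>u. form {..<n} (\<lambda>i j. A $$ (i, j)) u u = (\<Sum>k<n. ls ! k * (\<Sum>i<n. q k i * u i)\<^sup>2)"
    "\<And>u. (\<Sum>i<n. (u i)\<^sup>2) = (\<Sum>k<n. (\<Sum>i<n. q k i * u i)\<^sup>2)"
proof -
  obtain P where P: "P \<in> carrier_mat n n" and PP: "transpose_mat P * P = 1\<^sub>m n"
    and diag: "transpose_mat P * A * P = mat_diag n (\<lambda>i. ls ! i)"
    using real_symmetric_diagonalization[OF A sym char_poly_of_is_spectrum[OF A spec]] by blast
  have PT: "transpose_mat P \<in> carrier_mat n n" using P by simp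
  have PP': "P * transpose_mat P = 1\<^sub>m n" by (rule mat_mult_left_right_inverse[OF PT P PP])
  define q where "q = (\<lambda>k i. P $$ (i, k))"
  have quad: "(\<Sum>k<n. f k * (\<Sum>i<n. q k i * u i)\<^sup>2) = (\<Sum>i<n. \<Sum>j<n. (P * mat_diag n f * transpose_mat P) $$ (i, j) * u i * u j)" for f u
  proof -
    have e: "(P * mat_diag n f * transpose_mat P) $$ (i, j) = (\<Sum>k<n. f k * q k i * q k j)" if "i < n" "j < n" for i j
      using P that unfolding mat_diag_mult_right[OF P]
      by (simp add: scalar_prod_def q_def atLeast0LessThan mult_ac)
    have "(\<Sum>i<n. \<Sum>j<n. (P * mat_diag n f * transpose_mat P) $$ (i, j) * u i * u j)
        = (\<Sum>i<n. \<Sum>j<n. \<Sum>k<n. f k * ((q k i * u i) * (q k j * u j)))"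
      using e by (simp add: sum_distrib_left mult_ac)
    also have "\<dots> = (\<Sum>i<n. \<Sum>k<n. \<Sum>j<n. f k * ((q k i * u i) * (q k j * u j)))"
      by (intro sum.cong refl sum.swap)
    also have "\<dots> = (\<Sum>k<n. \<Sum>i<n. \<Sum>j<n. f k * ((q k i * u i) * (q k j * u j)))"
      by (rule sum.swap)
    also have "\<dots> = (\<Sum>k<n. f k * (\<Sum>i<n. q k i * u i)\<^sup>2)"
      by - (simp only: power2_eq_square sum_product, simp only: sum_distrib_left)
    finally show ?thesis ..
  qed
  show thesis
  proof (rule that[of q])
    fix k l assume kl: "k < n" "l < n"
    have "(\<Sum>i<n. q k i * q l i) = (transpose_mat P * P) $$ (k, l)"
      using P kl by (simp add: scalar_prod_def q_def atLeast0LessThan)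
    thus "(\<Sum>i<n. q k i * q l i) = (if k = l then 1 else 0)" unfolding PP using kl by simp
  next
    fix u
    have "P * mat_diag n (\<lambda>i. ls ! i) * transpose_mat P = (P * transpose_mat P) * A * (P * transpose_mat P)"
      unfolding diag[symmetric] using P PT A by (simp add: assoc_mult_mat[of _ n n _ n _ n])
    hence "P * mat_diag n (\<lambda>i. ls ! i) * transpose_mat P = A" unfolding PP' using A by simp
    thus "form {..<n} (\<lambda>i j. A $$ (i, j)) u u = (\<Sum>k<n. ls ! k * (\<Sum>i<n. q k i * u i)\<^sup>2)"
      unfolding form_def quad by simp
    have "mat_diag n (\<lambda>_. 1) = (1\<^sub>m n :: real mat)" unfolding mat_diag_def by (intro eq_matI) auto
    hence "P * mat_diag n (\<lambda>_. 1) * transpose_mat P = 1\<^sub>m n" using P PP' by simp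
    with quad[of "\<lambda>_. 1" u] have "(\<Sum>k<n. (\<Sum>i<n. q k i * u i)\<^sup>2) = (\<Sum>i<n. \<Sum>j<n. 1\<^sub>m n $$ (i, j) * u i * u j)"
      by simp
    also have "\<dots> = (\<Sum>i<n. (u i)\<^sup>2)"
    proof (intro sum.cong refl)
      fix i assume "i \<in> {..<n}"
      hence "(\<Sum>j<n. 1\<^sub>m n $$ (i, j) * u i * u j) = (\<Sum>j<n. if j = i then (u i)\<^sup>2 else 0)"
        by (intro sum.cong) (auto simp: power2_eq_square)
      thus "(\<Sum>j<n. 1\<^sub>m n $$ (i, j) * u i * u j) = (u i)\<^sup>2" using \<open>i \<in> {..<n}\<close> by simp
    qed
    finally show "(\<Sum>i<n. (u i)\<^sup>2) = (\<Sum>k<n. (\<Sum>i<n. q k i * u i)\<^sup>2)" ..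
  qed
qed

text \<open>
  For \<open>t < l3\<close> the first three eigenvectors span a space on which \<open>A - t * I\<close> is positive definite, and
  \<open>l1\<close> bounds the Rayleigh quotient, so \<open>positive_on_span_gap\<close> applies.
\<close>

lemma third_eigenvalue_bound:
  fixes A :: "real mat"
  assumes A: "A \<in> carrier_mat 5 5" and sym: "transpose_mat A = A" and nn: "entrywise_nonneg A"
    and spec: "is_spectrum_of [l1, l2, l3, l4, l5] A"
    and desc: "l1 \<ge> l2" "l2 \<ge> l3" "l3 \<ge> l4" "l4 \<ge> l5"
    and S: "S = l1 + l2 + l3 + l4 + l5" "S < l3"
  shows "9 * l3 - S < 4 * l1"
proof -
  define ls where "ls = [l1, l2, l3, l4, l5]"
  obtain q :: "nat \<Rightarrow> nat \<Rightarrow> real" where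
    orth: "\<And>k l. k < 5 \<Longrightarrow> l < 5 \<Longrightarrow> (\<Sum>i<5. q k i * q l i) = (if k = l then 1 else 0)"
    and quad: "\<And>u. form {..<5} (\<lambda>i j. A $$ (i, j)) u u = (\<Sum>k<5. ls ! k * (\<Sum>i<5. q k i * u i)\<^sup>2)"
    and norm: "\<And>u. (\<Sum>i<5. (u i)\<^sup>2) = (\<Sum>k<5. (\<Sum>i<5. q k i * u i)\<^sup>2)"
    using spectral_coordinates[OF A sym spec] unfolding ls_def by auto
  have nth: "ls ! 0 = l1" "ls ! 1 = l2" "ls ! 2 = l3" "ls ! 3 = l4" "ls ! 4 = l5"
    by (simp_all add: ls_def eval_nat_numeral)
  have sum5: "(\<Sum>k<5. f k) = f 0 + f 1 + f 2 + f 3 + f 4" for f :: "nat \<Rightarrow> real"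
    by (simp add: eval_nat_numeral)
  have A_sym: "A $$ (i, j) = A $$ (j, i)" if "i < 5" "j < 5" for i j
    using A that arg_cong[OF sym, of "\<lambda>M. M $$ (j, i)"] by simp
  have A_nonneg: "0 \<le> A $$ (i, j)" if "i < 5" "j < 5" for i j
    using nn A that unfolding entrywise_nonneg_def by auto
  have diag: "A $$ (i, i) = (\<Sum>k<5. ls ! k * (q k i)\<^sup>2)" if "i < 5" for i
  proof -
    let ?u = "\<lambda>j. if j = i then 1 else (0::real)"
    have "form {..<5} (\<lambda>i j. A $$ (i, j)) ?u ?u = A $$ (i, i)"
      unfolding form_def using that by (simp add: if_distrib[of "\<lambda>x. _ * x"] cong: if_cong)
    moreover have "(\<Sum>j<5. q k j * ?u j) = q k i" for k
      using that by (simp add: if_distrib[of "\<lambda>x. _ * x"] cong: if_cong)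
    ultimately show ?thesis using quad[of ?u] by simp
  qed
  have trace: "(\<Sum>i<5. A $$ (i, i)) = S"
  proof -
    have "(\<Sum>i<5. A $$ (i, i)) = (\<Sum>i<5. \<Sum>k<5. ls ! k * (q k i)\<^sup>2)"
      by (intro sum.cong refl diag) auto
    also have "\<dots> = (\<Sum>k<5. \<Sum>i<5. ls ! k * (q k i)\<^sup>2)" by (rule sum.swap)
    also have "\<dots> = (\<Sum>k<5. ls ! k * (\<Sum>i<5. q k i * q k i))"
      by (simp add: sum_distrib_left power2_eq_square)
    also have "\<dots> = (\<Sum>k<5. ls ! k)" using orth by simp
    finally show ?thesis unfolding sum5[of "\<lambda>k. ls ! k"] nth S(1) .
  qed
  have S0: "0 \<le> S" unfolding trace[symmetric] using A_nonneg by (intro sum_nonneg) auto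
  have top: "form {..<5} (\<lambda>i j. A $$ (i, j)) u u \<le> l1 * (\<Sum>i<5. (u i)\<^sup>2)" for u
    unfolding quad[of u] norm[of u] sum_distrib_left
  proof (intro sum_mono mult_right_mono)
    fix k :: nat assume "k \<in> {..<5}"
    hence "k = 0 \<or> k = 1 \<or> k = 2 \<or> k = 3 \<or> k = 4" by auto
    thus "ls ! k \<le> l1" using nth desc by auto
  qed auto
  have gap: "(5 * t - S) / 4 * (1 + ((t - S) / (5 * t - S))\<^sup>2 / 4) \<le> l1 - t" if t: "S < t" "t < l3" for t
  proof -
    have shift: "form {..<5} (\<lambda>i j. A $$ (i, j) - (if i = j then t else 0)) u u
        = (\<Sum>k<5. (ls ! k - t) * (\<Sum>i<5. q k i * u i)\<^sup>2)" for u
    proof -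
      have "form {..<5} (\<lambda>i j. A $$ (i, j) - (if i = j then t else 0)) u u
          = form {..<5} (\<lambda>i j. A $$ (i, j)) u u - t * (\<Sum>i<5. (u i)\<^sup>2)"
        unfolding form_def
        by (simp add: left_diff_distrib sum_subtractf if_distrib[of "\<lambda>x. x * _"] sum_distrib_left
            power2_eq_square mult.assoc cong: if_cong)
      thus ?thesis unfolding quad[of u] norm[of u] by (simp add: left_diff_distrib sum_subtractf sum_distrib_left)
    qed
    have "positive_on_span {..<5} (\<lambda>i j. A $$ (i, j) - (if i = j then t else 0)) (q 0) (q 1) (q 2)"
      unfolding positive_on_span_def
    proof (intro allI impI)
      fix r s p :: real assume rsp: "r \<noteq> 0 \<or> s \<noteq> 0 \<or> p \<noteq> 0"
      define u where "u = (\<lambda>i. r * q 0 i + s * q 1 i + p * q 2 i)"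
      have c: "(\<Sum>i<5. q k i * u i) = r * (\<Sum>i<5. q k i * q 0 i) + s * (\<Sum>i<5. q k i * q 1 i) + p * (\<Sum>i<5. q k i * q 2 i)" for k
        unfolding u_def by (simp add: sum.distrib sum_distrib_left algebra_simps)
      have "form {..<5} (\<lambda>i j. A $$ (i, j) - (if i = j then t else 0)) u u
          = (l1 - t) * r\<^sup>2 + (l2 - t) * s\<^sup>2 + (l3 - t) * p\<^sup>2"
        unfolding shift c sum5[of "\<lambda>k. (ls ! k - t) * _ k"] nth using orth by simp
      also have "\<dots> > 0"
      proof -
        have "0 \<le> (l1 - t) * r\<^sup>2" "0 \<le> (l2 - t) * s\<^sup>2" "0 \<le> (l3 - t) * p\<^sup>2" using desc t by auto
        moreover have "0 < (l1 - t) * r\<^sup>2 \<or> 0 < (l2 - t) * s\<^sup>2 \<or> 0 < (l3 - t) * p\<^sup>2" using rsp desc t by auto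
        ultimately show ?thesis by linarith
      qed
      finally show "0 < form {..<5} (\<lambda>i j. A $$ (i, j) - (if i = j then t else 0))
          (\<lambda>i. r * q 0 i + s * q 1 i + p * q 2 i) (\<lambda>i. r * q 0 i + s * q 1 i + p * q 2 i)" unfolding u_def .
    qed
    note P = this
    have I: "{..<5} = {0, 1, 2, 3, 4 :: nat}" "distinct [0, 1, 2, 3, 4 :: nat]" by auto
    show ?thesis
      by (rule positive_on_span_gap[OF I _ _ _ P top, unfolded trace]) (use A_sym A_nonneg t(1) in auto)
  qed
  \<comment> \<open>letting \<open>t\<close> tend to \<open>l3\<close> keeps the quadratic surplus, which makes the limiting inequality strict\<close>
  have "0 \<le> (l1 - l3) - (5 * l3 - S) / 4 * (1 + ((l3 - S) / (5 * l3 - S))\<^sup>2 / 4)"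
  proof (rule tendsto_lowerbound)
    show "((\<lambda>t. (l1 - t) - (5 * t - S) / 4 * (1 + ((t - S) / (5 * t - S))\<^sup>2 / 4))
       \<longlongrightarrow> (l1 - l3) - (5 * l3 - S) / 4 * (1 + ((l3 - S) / (5 * l3 - S))\<^sup>2 / 4)) (at_left l3)"
      using S0 S(2) by (intro tendsto_intros) auto
    show "\<forall>\<^sub>F t in at_left l3. 0 \<le> (l1 - t) - (5 * t - S) / 4 * (1 + ((t - S) / (5 * t - S))\<^sup>2 / 4)"
      using gap S(2) by (intro eventually_at_leftI[of S]) auto
  qed simp
  moreover have "(5 * l3 - S) / 4 * 1 < (5 * l3 - S) / 4 * (1 + ((l3 - S) / (5 * l3 - S))\<^sup>2 / 4)"
    using S0 S(2) by (intro mult_strict_left_mono) auto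
  ultimately have "(5 * l3 - S) / 4 < l1 - l3" by simp
  thus ?thesis by simp
qed

theorem theorem2p1:
  fixes ls :: "real list"
  assumes "ls \<in> W_lists"
  shows "\<not> (\<exists>A :: real mat. A \<in> carrier_mat 5 5 \<and> transpose_mat A = A \<and>
               entrywise_nonneg A \<and> is_spectrum_of ls A)"
proof -
  from assms obtain l1 l2 l3 l4 l5 where ls: "ls = [l1, l2, l3, l4, l5]"
    and W: "l1 \<ge> l2" "l2 \<ge> l3" "l3 \<ge> l4" "l4 \<ge> l5" "l1 + l2 + l3 + l4 + l5 < l3"
      "4 * l1 \<le> 9 * l3 - (l1 + l2 + l3 + l4 + l5)"
    unfolding W_lists_def Let_def by auto
  show ?thesis
  proof
    assume "\<exists>A :: real mat. A \<in> carrier_mat 5 5 \<and> transpose_mat A = A \<and> entrywise_nonneg A \<and> is_spectrum_of ls A"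
    then obtain A :: "real mat" where A: "A \<in> carrier_mat 5 5" "transpose_mat A = A" "entrywise_nonneg A"
      "is_spectrum_of [l1, l2, l3, l4, l5] A" unfolding ls by blast
    from third_eigenvalue_bound[OF A W(1-4) refl W(5)] W(6) show False by simp
  qed
qed

end
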